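(* Let $p$ be prime, $\mathcal A=\mathbb Z/p$, and let $\Phi:\mathcal A^{\mathbb L}\to\mathcal A^{\mathbb L}$ be a linear cellular automaton with $\mathrm{trace}[\Phi]=0$ in $\mathbb Z/p$. Then for $\lambda^D$-almost every $(\alpha_1,\dots,\alpha_D)\in\mathbf T^D$ (with $\varsigma$ the corresponding $\mathbb Z^D$-action on $\mathbf T$), there are no nontrivial $\Phi$-invariant $\varsigma$-quasisturmian measures, i.e. no $\Phi$-invariant $\varsigma$-quasisturmian measure other than the point mass at the constant zero configuration.
   Context: $D,K\ge1$, $\mathbb L=\mathbb Z^D$, $\mathbf T=(\mathbb R/\mathbb Z)^K$, $\lambda$ Lebesgue (Haar) probability measure on $\mathbf T$, $\lambda^D$ the product measure on $\mathbf T^D$. For $(\alpha_1,\dots,\alpha_D)\in\mathbf T^D$ put $\tau(\ell)=\ell_1\alpha_1+\cdots+\ell_D\alpha_D$ and $\varsigma^\ell(t)=t+\tau(\ell)$; only $(\alpha_d)$ for which $\tau$ is injective with dense image are considered (a full-measure set). A linear cellular automaton is $\Phi(\mathbf a)_\ell=\sum_{b\in B}\varphi_b\,a_{\ell+b}\pmod p$ with $B\subset\mathbb L$ finite and constants $\varphi_b\in\{1,\dots,p-1\}$; $\mathrm{trace}[\Phi]=\sum_{b\in B}\varphi_b\bmod p$. A measurable partition is a family $\mathcal P=\{P_a\}_{a\in\mathcal A}$ of disjoint measurable subsets of $\mathbf T$ with $\lambda(\bigsqcup_aP_a)=1$. For $\lambda$-a.e. $t$, $\mathcal P_\varsigma(t)\in\mathcal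 A^{\mathbb L}$ is the sequence whose $\ell$-th entry is the unique $a$ with $\varsigma^\ell(t)\in P_a$. A $\varsigma$-quasisturmian measure on $\mathcal A^{\mathbb L}$ is the push-forward $\mathcal P_\varsigma(\lambda)$ for some measurable partition $\mathcal P$. A measure $\mu$ is $\Phi$-invariant if its push-forward $\Phi(\mu)$ equals $\mu$. *)

theory Defs
  imports "HOL-Probability.Probability" "HOL-Computational_Algebra.Primes"
begin

text \<open>
  The circle \<open>\<real>/\<int>\<close>, as a topological abelian group. The torus \<open>(\<real>/\<int>)^K\<close> is then
  \<open>circle ^ 'k\<close> and inherits its group structure and product topology from the library
  instances for finite Cartesian powers.
\<close>

quotient_type circle = real / "\<lambda>x y. x - y \<in> \<int>"
proof (rule equivpI)
  show "reflp (\<lambda>x y :: real. x - y \<in> \<int>)"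
    by (simp add: reflp_def)
  show "symp (\<lambda>x y :: real. x - y \<in> \<int>)"
    by (metis (mono_tags, lifting) Ints_minus minus_diff_eq sympI)
  show "transp (\<lambda>x y :: real. x - y \<in> \<int>)"
    by (rule transpI) (metis Ints_add diff_add_cancel add_diff_eq)
qed

instantiation circle :: ab_group_add
begin

lift_definition zero_circle :: circle is "0 :: real" .

lift_definition plus_circle :: "circle \<Rightarrow> circle \<Rightarrow> circle" is "(+)"
  by (metis Ints_add add_diff_add)

lift_definition uminus_circle :: "circle \<Rightarrow> circle" is "uminus"
  by (metis Ints_minus minus_diff_minus)

lift_definition minus_circle :: "circle \<Rightarrow> circle \<Rightarrow> circle" is "(-)"
  by (metis Ints_diff diff_diff_eq2 diff_diff_add add_diff_eq diff_add_eq add.commute)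

instance
  by (standard; transfer; simp)

end

instantiation circle :: topological_space
begin

text \<open>The quotient topology.\<close>

definition open_circle :: "circle set \<Rightarrow> bool" where
  "open_circle U \<longleftrightarrow> open (abs_circle -` U)"

instance
  by standard (auto simp: open_circle_def vimage_Union intro!: open_Int)

end

lemma continuous_on_abs_circle: "continuous_on S abs_circle"
  by (rule continuous_on_subset[OF _ subset_UNIV])
    (simp add: continuous_on_open_vimage open_circle_def)

lift_definition circle_zmult :: "int \<Rightarrow> circle \<Rightarrow> circle" is "\<lambda>n x. of_int n * x"
  by (metis Ints_mult Ints_of_int right_diff_distrib)

definition torus_zmult :: "int \<Rightarrow> circle ^ 'k \<Rightarrow> circle ^ 'k" where
  "torus_zmult n t = (\<chi> i. circle_zmult n (t $ i))"

definition torus_proj :: "real ^ 'k \<Rightarrow> circle ^ 'k" where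
  "torus_proj x = (\<chi> i. abs_circle (x $ i))"

definition unit_cube :: "(real ^ 'k) set" where
  "unit_cube = {x. \<forall>i. 0 \<le> x $ i \<and> x $ i < 1}"

text \<open>
  Lebesgue probability measure on the torus: the completed image of Lebesgue measure on the
  fundamental domain \<open>[0,1)^K\<close>. Because of the completion, its measurable sets are all
  Lebesgue measurable sets and not just the Borel sets.
\<close>

definition torus_lebesgue :: "(circle ^ 'k) measure" where
  "torus_lebesgue = completion (distr (restrict_space lborel unit_cube) borel torus_proj)"

lemma measurable_torus_proj:
  "(torus_proj :: real ^ 'k \<Rightarrow> circle ^ 'k) \<in> borel_measurable (restrict_space lborel unit_cube)"
proof -
  have "continuous_on UNIV (torus_proj :: real ^ 'k \<Rightarrow> circle ^ 'k)"
    unfolding torus_proj_def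
    by (intro continuous_on_vec_lambda continuous_on_compose2[OF continuous_on_abs_circle[of UNIV]]
        continuous_intros) auto
  then show ?thesis
    by (intro measurable_restrict_space1) (simp add: borel_measurable_continuous_onI)
qed

lemma prob_space_torus_lebesgue: "prob_space (torus_lebesgue :: (circle ^ 'k) measure)"
proof -
  have cube: "unit_cube \<in> sets (lborel :: (real ^ 'k) measure)"
    unfolding unit_cube_def by measurable
  have "emeasure lborel (unit_cube :: (real ^ 'k) set) = 1"
  proof -
    have "emeasure lborel (box 0 (\<chi> i. 1) :: (real ^ 'k) set) = 1"
      "emeasure lborel (cbox 0 (\<chi> i. 1) :: (real ^ 'k) set) = 1"
      by (auto simp: emeasure_lborel_box_eq emeasure_lborel_cbox_eq Basis_vec_def inner_axis
          intro!: prod.neutral)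
    moreover have "box 0 (\<chi> i. 1) \<subseteq> (unit_cube :: (real ^ 'k) set)"
      "unit_cube \<subseteq> (cbox 0 (\<chi> i. 1) :: (real ^ 'k) set)"
      by (auto simp: unit_cube_def mem_box_cart less_imp_le)
    moreover have "cbox 0 (\<chi> i. 1) \<in> sets (lborel :: (real ^ 'k) measure)"
      by simp
    ultimately show ?thesis
      using cube emeasure_mono[of "box 0 (\<chi> i. 1)" unit_cube "lborel :: (real ^ 'k) measure"]
        emeasure_mono[of unit_cube "cbox 0 (\<chi> i. 1)" "lborel :: (real ^ 'k) measure"]
      by (intro antisym) simp_all
  qed
  then have "prob_space (restrict_space lborel (unit_cube :: (real ^ 'k) set))"
    using cube by (intro prob_spaceI) (simp add: space_restrict_space emeasure_restrict_space)
  then have "prob_space (distr (restrict_space lborel unit_cube) borel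
      (torus_proj :: real ^ 'k \<Rightarrow> circle ^ 'k))"
    by (rule prob_space.prob_space_distr[OF _ measurable_torus_proj])
  then show ?thesis
    unfolding torus_lebesgue_def by (rule prob_space.prob_space_completion)
qed

definition tau :: "('d \<Rightarrow> circle ^ 'k) \<Rightarrow> int ^ 'd \<Rightarrow> circle ^ 'k" where
  "tau \<alpha> l = (\<Sum>d\<in>UNIV. torus_zmult (l $ d) (\<alpha> d))"

definition rotation :: "('d \<Rightarrow> circle ^ 'k) \<Rightarrow> int ^ 'd \<Rightarrow> circle ^ 'k \<Rightarrow> circle ^ 'k" where
  "rotation \<alpha> l t = t + tau \<alpha> l"

definition admissible :: "('d::finite \<Rightarrow> circle ^ 'k) \<Rightarrow> bool" where
  "admissible \<alpha> \<longleftrightarrow> inj (tau \<alpha>) \<and> closure (range (tau \<alpha>)) = UNIV"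

text \<open>
  The alphabet \<open>\<int>/p\<close> is represented by the residues \<open>{..<p}\<close>; configurations are functions
  \<open>int ^ 'd \<Rightarrow> nat\<close> with values in the alphabet, carrying the product \<open>\<sigma>\<close>-algebra.
\<close>

definition config_space :: "nat \<Rightarrow> (int ^ 'd \<Rightarrow> nat) measure" where
  "config_space p = (\<Pi>\<^sub>M l\<in>UNIV. count_space {..<p})"

definition linear_ca ::
    "nat \<Rightarrow> (int ^ 'd) set \<Rightarrow> (int ^ 'd \<Rightarrow> nat) \<Rightarrow> (int ^ 'd \<Rightarrow> nat) \<Rightarrow> int ^ 'd \<Rightarrow> nat" where
  "linear_ca p B \<phi> a l = (\<Sum>b\<in>B. \<phi> b * a (l + b)) mod p"

definition ca_trace :: "nat \<Rightarrow> (int ^ 'd) set \<Rightarrow> (int ^ 'd \<Rightarrow> nat) \<Rightarrow> nat" where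
  "ca_trace p B \<phi> = (\<Sum>b\<in>B. \<phi> b) mod p"

definition ca_invariant ::
    "nat \<Rightarrow> ((int ^ 'd \<Rightarrow> nat) \<Rightarrow> (int ^ 'd \<Rightarrow> nat)) \<Rightarrow> (int ^ 'd \<Rightarrow> nat) measure \<Rightarrow> bool" where
  "ca_invariant p \<Phi> \<mu> \<longleftrightarrow> distr \<mu> (config_space p) \<Phi> = \<mu>"

definition measurable_partition :: "nat \<Rightarrow> (nat \<Rightarrow> (circle ^ 'k) set) \<Rightarrow> bool" where
  "measurable_partition p P \<longleftrightarrow>
     (\<forall>a<p. P a \<in> sets torus_lebesgue) \<and>
     disjoint_family_on P {..<p} \<and>
     emeasure torus_lebesgue (\<Union>a<p. P a) = 1"

text \<open>
  The itinerary of \<open>t\<close> is determined only for almost every \<open>t\<close>. An entry at which the orbit of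
  \<open>t\<close> misses all cells is given the value \<open>0\<close>, so that itineraries are always configurations;
  this does not affect the push-forward of Lebesgue measure.
\<close>

definition itinerary ::
    "nat \<Rightarrow> (nat \<Rightarrow> (circle ^ 'k) set) \<Rightarrow> ('d \<Rightarrow> circle ^ 'k) \<Rightarrow> circle ^ 'k \<Rightarrow> int ^ 'd \<Rightarrow> nat" where
  "itinerary p P \<alpha> t l =
     (if \<exists>a<p. rotation \<alpha> l t \<in> P a then THE a. a < p \<and> rotation \<alpha> l t \<in> P a else 0)"

definition quasisturmian ::
    "nat \<Rightarrow> ('d \<Rightarrow> circle ^ 'k) \<Rightarrow> (int ^ 'd \<Rightarrow> nat) measure \<Rightarrow> bool" where
  "quasisturmian p \<alpha> \<mu> \<longleftrightarrow>
     (\<exists>P. measurable_partition p P \<and> \<mu> = distr torus_lebesgue (config_space p) (itinerary p P \<alpha>))"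

end

theory Submission
  imports Defs "HOL-Library.Function_Algebras" "HOL-Number_Theory.Residues"
begin

text \<open>
  Write \<open>\<Phi>\<close> for the automaton and \<open>\<tau>\<close> for the homomorphism defined by the generators \<open>\<alpha>\<close>.
  Modulo \<open>p\<close>, the iterate \<open>\<Phi>\<close> to the power \<open>p ^ n\<close> has the same coefficients as \<open>\<Phi>\<close>, on the
  neighbourhood dilated by \<open>p ^ n\<close> (lemma \<open>funpow_prime_power_linear_ca\<close>). Applied to the itinerary
  of a point \<open>t\<close>, it combines, with the coefficients \<open>\<phi> b\<close>, the letters of the points
  \<open>t + \<tau> l + \<tau> (p ^ n b)\<close>.

  For almost every \<open>\<alpha>\<close>, the multiples \<open>p ^ n \<alpha>\<close> come arbitrarily close to \<open>0\<close>, in all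
  coordinates simultaneously (lemma \<open>AE_multiples_approach_0\<close>). The reason is that multiplication by
  \<open>q = p ^ m\<close> preserves Lebesgue measure and that a visit to the cube of side \<open>1 / q\<close> at the origin
  is independent of the future of the orbit, so the set of orbits that never visit the cube is
  null.

  For such \<open>n\<close> the translations by \<open>\<tau> (p ^ n b)\<close> are short, and translation is continuous in measure
  (lemma \<open>set_almost_translation_invariant\<close>): outside a set of small measure, the point \<open>t + \<tau> l\<close> and
  all its translates lie in the same cell and carry the same letter \<open>a\<close>. There the output is \<open>a\<close> times
  the trace, which is \<open>0\<close>. If the measure is \<open>\<Phi>\<close>-invariant, the output of the iterate has the law
  of the input. Hence the letter at \<open>l\<close> is nonzero with arbitrarily small probability, so it is
  almost surely \<open>0\<close> for each \<open>l\<close>, and the measure is the point mass at \<open>0\<close>.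
\<close>

section \<open>Frobenius powers of linear cellular automata\<close>

lemma additive_of_nat_mult:
  fixes X :: "'a::comm_semiring_1 \<Rightarrow> 'a"
  assumes "X 0 = 0" "\<And>u v. X (u + v) = X u + X v"
  shows "X (of_nat n * u) = of_nat n * X u"
  by (induction n) (simp_all add: assms distrib_right)

lemma additive_sum:
  fixes X :: "'a::comm_semiring_1 \<Rightarrow> 'a"
  assumes "X 0 = 0" "\<And>u v. X (u + v) = X u + X v"
  shows "X (sum f A) = (\<Sum>i\<in>A. X (f i))"
  by (induction A rule: infinite_finite_induct) (simp_all add: assms)

text \<open>
  An automaton is a sum of weighted shifts. These are additive operators that commute with one
  another, so that its powers follow the binomial theorem. The operators act on an arbitrary
  commutative semiring, which is below the semiring of all \<open>nat\<close>-valued configurations with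
  pointwise operations.
\<close>

lemma binomial_commuting_additive:
  fixes X Y :: "'a::comm_semiring_1 \<Rightarrow> 'a"
  assumes X: "X 0 = 0" "\<And>u v. X (u + v) = X u + X v"
    and Y: "Y 0 = 0" "\<And>u v. Y (u + v) = Y u + Y v"
    and XY: "\<And>u. Y (X u) = X (Y u)"
  shows "((\<lambda>u. X u + Y u) ^^ n) u = (\<Sum>k\<le>n. of_nat (n choose k) * (X ^^ k) ((Y ^^ (n - k)) u))"
proof (induction n)
  case (Suc n)
  have comm: "Y ((X ^^ k) u) = (X ^^ k) (Y u)" for k u
    by (induction k) (simp_all add: XY)
  let ?t = "\<lambda>m k. (X ^^ k) ((Y ^^ (m - k)) u)"
  have tX: "X (?t n k) = ?t (Suc n) (Suc k)" for k by simp
  have tY: "Y (?t n k) = ?t (Suc n) k" if "k \<le> n" for k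
    using that by (simp add: comm Suc_diff_le)
  have "((\<lambda>u. X u + Y u) ^^ Suc n) u
      = X (\<Sum>k\<le>n. of_nat (n choose k) * ?t n k) + Y (\<Sum>k\<le>n. of_nat (n choose k) * ?t n k)"
    by (simp only: funpow.simps comp_apply Suc.IH)
  also have "X (\<Sum>k\<le>n. of_nat (n choose k) * ?t n k)
      = (\<Sum>k\<le>n. of_nat (n choose k) * ?t (Suc n) (Suc k))"
    by (simp only: additive_sum[of X, OF X] additive_of_nat_mult[of X, OF X] tX)
  also have "Y (\<Sum>k\<le>n. of_nat (n choose k) * ?t n k)
      = (\<Sum>k\<le>n. of_nat (n choose k) * ?t (Suc n) k)"
    by (simp only: additive_sum[of Y, OF Y] additive_of_nat_mult[of Y, OF Y])
       (intro sum.cong refl, simp only: tY atMost_iff)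
  also have "(\<Sum>k\<le>n. of_nat (n choose k) * ?t (Suc n) k)
      = ?t (Suc n) 0 + (\<Sum>k\<le>n. of_nat (n choose Suc k) * ?t (Suc n) (Suc k))"
    using sum.atMost_Suc_shift[of "\<lambda>k. of_nat (n choose k) * ?t (Suc n) k" n]
    by (simp add: binomial_eq_0)
  also have "(\<Sum>k\<le>n. of_nat (n choose k) * ?t (Suc n) (Suc k)) + \<dots>
      = (\<Sum>k\<le>Suc n. of_nat (Suc n choose k) * ?t (Suc n) k)"
    unfolding sum.atMost_Suc_shift by (simp add: sum.distrib distrib_right ac_simps)
  finally show ?case .
qed simp

text \<open>
  A prime divides the inner binomial coefficients, and so only the two pure powers survive
  modulo \<open>p\<close>.
\<close>

lemma freshmans_dream_commuting_additive:
  fixes X Y :: "'a::comm_semiring_1 \<Rightarrow> 'a"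
  assumes "X 0 = 0" "\<And>u v. X (u + v) = X u + X v"
    and "Y 0 = 0" "\<And>u v. Y (u + v) = Y u + Y v"
    and "\<And>u. Y (X u) = X (Y u)" and p: "prime p"
  shows "\<exists>w. ((\<lambda>u. X u + Y u) ^^ p) u = (X ^^ p) u + (Y ^^ p) u + of_nat p * w"
proof -
  let ?t = "\<lambda>k. (X ^^ k) ((Y ^^ (p - k)) u)"
  have p0: "p > 0" using p by (rule prime_gt_0_nat)
  then have S: "{..p} = insert 0 (insert p {0<..<p})" by auto
  have "of_nat (p choose k) * ?t k = of_nat p * (of_nat ((p choose k) div p) * ?t k)"
    if "k \<in> {0<..<p}" for k
  proof -
    have "p dvd (p choose k)" using that p by (intro dvd_choose_prime) auto
    then have "(p choose k) = p * ((p choose k) div p)" by simp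
    then have "(of_nat (p choose k) :: 'a) = of_nat p * of_nat ((p choose k) div p)"
      by (metis of_nat_mult)
    then show ?thesis by (simp only: mult.assoc)
  qed
  then have "(\<Sum>k\<in>{0<..<p}. of_nat (p choose k) * ?t k)
      = of_nat p * (\<Sum>k\<in>{0<..<p}. of_nat ((p choose k) div p) * ?t k)"
    by (simp add: sum_distrib_left)
  moreover have "((\<lambda>u. X u + Y u) ^^ p) u = (\<Sum>k\<le>p. of_nat (p choose k) * ?t k)"
    by (rule binomial_commuting_additive) (use assms in auto)
  ultimately have "((\<lambda>u. X u + Y u) ^^ p) u = (X ^^ p) u + (Y ^^ p) u
      + of_nat p * (\<Sum>k\<in>{0<..<p}. of_nat ((p choose k) div p) * ?t k)"
    using p0 by (simp add: S add_ac)
  then show ?thesis by blast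
qed

text \<open>
  The automaton before reduction modulo \<open>p\<close>. The displacements \<open>v i\<close> are separated from the index
  set so that scaling the neighbourhood changes \<open>v\<close> alone; in particular no injectivity of the
  scaling has to be tracked.
\<close>

definition shift_comb ::
    "'i set \<Rightarrow> ('i \<Rightarrow> nat) \<Rightarrow> ('i \<Rightarrow> int ^ 'd) \<Rightarrow> (int ^ 'd \<Rightarrow> nat) \<Rightarrow> int ^ 'd \<Rightarrow> nat" where
  "shift_comb I c v a l = (\<Sum>i\<in>I. c i * a (l + v i))"

lemma funpow_weighted_shift:
  fixes s :: "int ^ 'd"
  shows "((\<lambda>a l. c * a (l + s)) ^^ n) a = (\<lambda>l. c ^ n * a (l + int n *s s) :: nat)"
  by (induction n)
     (auto simp: fun_eq_iff mult_ac add_ac vector_space_over_itself.scale_left_distrib vector_sadd_rdistrib)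

text \<open>
  Peeling off one weighted shift at a time reduces the Frobenius identity to the case of two
  summands.
\<close>

lemma funpow_prime_shift_comb:
  assumes p: "prime p" and "finite I"
  shows "\<exists>w. (shift_comb I c v ^^ p) a
      = shift_comb I (\<lambda>i. c i ^ p) (\<lambda>i. int p *s v i) a + of_nat p * w"
  using \<open>finite I\<close>
proof (induction I)
  case empty
  have "(shift_comb {} c v ^^ p) a = 0"
    using prime_gt_0_nat[OF p] by (cases p) (auto simp: shift_comb_def fun_eq_iff)
  moreover have "shift_comb {} (\<lambda>i. c i ^ p) (\<lambda>i. int p *s v i) a = 0"
    by (auto simp: shift_comb_def fun_eq_iff)
  ultimately show ?case by (intro exI[of _ 0]) simp
next
  case (insert i I)
  let ?X = "\<lambda>a l. c i * a (l + v i)"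
  have split: "shift_comb (insert i I) c v = (\<lambda>u. ?X u + shift_comb I c v u)"
    using insert.hyps by (auto simp: fun_eq_iff shift_comb_def)
  have "\<exists>w. ((\<lambda>u. ?X u + shift_comb I c v u) ^^ p) a
      = (?X ^^ p) a + (shift_comb I c v ^^ p) a + of_nat p * w"
    by (rule freshmans_dream_commuting_additive)
       (auto simp: fun_eq_iff shift_comb_def sum.distrib sum_distrib_left algebra_simps p)
  then obtain w where w: "(shift_comb (insert i I) c v ^^ p) a
      = (?X ^^ p) a + (shift_comb I c v ^^ p) a + of_nat p * w"
    unfolding split by blast
  from insert.IH obtain w' where w': "(shift_comb I c v ^^ p) a
      = shift_comb I (\<lambda>i. c i ^ p) (\<lambda>i. int p *s v i) a + of_nat p * w'" by blast
  show ?case unfolding w w' using insert.hyps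
    by (intro exI[of _ "w + w'"])
       (auto simp: fun_eq_iff funpow_weighted_shift shift_comb_def algebra_simps)
qed

lemma fermat_little:
  fixes c p :: nat
  assumes "prime p"
  shows "c ^ p mod p = c mod p"
proof (cases "p dvd c")
  case True
  moreover have "c dvd c ^ p" using prime_gt_0_nat[OF assms] by simp
  ultimately have "p dvd c ^ p" by (rule dvd_trans)
  then show ?thesis using True by simp
next
  case False
  then have "[c ^ (p - 1) = 1] (mod p)" using assms by (intro fermat_theorem)
  then have "[c * c ^ (p - 1) = c * 1] (mod p)" by (rule cong_scalar_left)
  moreover have "c * c ^ (p - 1) = c ^ p" using prime_gt_0_nat[OF assms] by (cases p) auto
  ultimately show ?thesis by (simp add: cong_def)
qed

lemma shift_comb_cong_mod:
  assumes "\<And>i. i \<in> I \<Longrightarrow> c i mod p = c' i mod p" "\<And>l. a l mod p = a' l mod p"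
  shows "shift_comb I c v a l mod p = shift_comb I c' v a' l mod p"
proof -
  have "[(\<Sum>i\<in>I. c i * a (l + v i)) = (\<Sum>i\<in>I. c' i * a' (l + v i))] (mod p)"
    by (intro cong_sum cong_mult) (simp_all only: cong_def assms)
  then show ?thesis by (simp add: shift_comb_def cong_def)
qed

definition shift_ca :: "nat \<Rightarrow> 'i set \<Rightarrow> ('i \<Rightarrow> nat) \<Rightarrow> ('i \<Rightarrow> int ^ 'd) \<Rightarrow> (int ^ 'd \<Rightarrow> nat) \<Rightarrow> int ^ 'd \<Rightarrow> nat"
  where "shift_ca p I c v a l = shift_comb I c v a l mod p"

lemma funpow_shift_ca:
  "(shift_ca p I c v ^^ n) a l mod p = (shift_comb I c v ^^ n) a l mod p"
proof (induction n arbitrary: l)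
  case (Suc n)
  have "shift_comb I c v ((shift_ca p I c v ^^ n) a) l mod p
      = shift_comb I c v ((shift_comb I c v ^^ n) a) l mod p"
    by (rule shift_comb_cong_mod) (simp_all add: Suc.IH)
  then show ?case by (simp add: shift_ca_def[of p I c v "(shift_ca p I c v ^^ n) a"])
qed simp

text \<open>
  By Fermat's little theorem the coefficients \<open>c i ^ p\<close> of the \<open>p\<close>-th power reduce to \<open>c i\<close> again:
  the \<open>p\<close>-th iterate is the same automaton on a neighbourhood dilated by \<open>p\<close>.
\<close>

lemma funpow_prime_shift_ca:
  assumes p: "prime p" and "finite I"
  shows "shift_ca p I c v ^^ p = shift_ca p I c (\<lambda>i. int p *s v i)"
proof (intro ext)
  fix a l
  obtain w where w: "(shift_comb I c v ^^ p) a
      = shift_comb I (\<lambda>i. c i ^ p) (\<lambda>i. int p *s v i) a + of_nat p * w"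
    using funpow_prime_shift_comb[OF assms] by blast
  obtain q where q: "p = Suc q" using prime_gt_0_nat[OF p] by (cases p) auto
  have "(shift_ca p I c v ^^ p) a l = (shift_ca p I c v ^^ p) a l mod p"
    by (subst (1 3) q) (simp add: shift_ca_def)
  also have "\<dots> = shift_comb I (\<lambda>i. c i ^ p) (\<lambda>i. int p *s v i) a l mod p"
    by (simp add: funpow_shift_ca w)
  also have "\<dots> = shift_ca p I c (\<lambda>i. int p *s v i) a l"
    unfolding shift_ca_def by (rule shift_comb_cong_mod) (simp_all add: fermat_little p)
  finally show "(shift_ca p I c v ^^ p) a l = shift_ca p I c (\<lambda>i. int p *s v i) a l" .
qed

lemma funpow_prime_power_linear_ca:
  assumes p: "prime p" and "finite B"
  shows "(linear_ca p B \<phi> ^^ (p ^ n)) a l = (\<Sum>b\<in>B. \<phi> b * a (l + int (p ^ n) *s b)) mod p"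
proof -
  have "shift_ca p B \<phi> (\<lambda>b. b) ^^ (p ^ n) = shift_ca p B \<phi> (\<lambda>b. int (p ^ n) *s b)"
  proof (induction n)
    case (Suc n)
    have "shift_ca p B \<phi> (\<lambda>b. b) ^^ (p ^ Suc n) = (shift_ca p B \<phi> (\<lambda>b. b) ^^ (p ^ n)) ^^ p"
      by (simp add: funpow_mult mult.commute)
    also have "\<dots> = shift_ca p B \<phi> (\<lambda>b. int p *s (int (p ^ n) *s b))"
      unfolding Suc.IH by (rule funpow_prime_shift_ca[OF assms])
    finally show ?case by (simp add: vector_smult_assoc)
  qed simp
  moreover have "linear_ca p B \<phi> = shift_ca p B \<phi> (\<lambda>b. b)"
    by (simp add: fun_eq_iff linear_ca_def shift_ca_def shift_comb_def)
  ultimately show ?thesis by (simp add: shift_ca_def shift_comb_def)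
qed

section \<open>Invariance of Lebesgue measure on the torus\<close>

lemma abs_circle_eq_iff: "abs_circle x = abs_circle y \<longleftrightarrow> x - y \<in> \<int>"
  by (rule circle.abs_eq_iff)

lemma torus_proj_eq_iff: "torus_proj x = torus_proj y \<longleftrightarrow> (\<forall>i. x $ i - y $ i \<in> \<int>)"
  by (simp add: torus_proj_def vec_eq_iff abs_circle_eq_iff)

lemma torus_proj_add: "torus_proj (x + y) = torus_proj x + torus_proj y"
  by (simp add: torus_proj_def vec_eq_iff plus_circle.abs_eq)

lemma torus_proj_zmult: "torus_proj (of_int n *\<^sub>R x) = torus_zmult n (torus_proj x)"
  by (simp add: torus_proj_def torus_zmult_def vec_eq_iff circle_zmult.abs_eq)

lemma torus_proj_surj: "\<exists>x. torus_proj x = t"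
proof -
  have "\<exists>x. abs_circle x = t $ i" for i
    by (metis Quotient_abs_rep Quotient_circle)
  then obtain f where "\<And>i. abs_circle (f i) = t $ i" by metis
  then show ?thesis
    by (intro exI[of _ "\<chi> i. f i"]) (simp add: torus_proj_def vec_eq_iff)
qed

lemma borel_measurable_torus_proj [measurable]:
  "(torus_proj :: real ^ 'k \<Rightarrow> circle ^ 'k) \<in> borel_measurable borel"
  unfolding torus_proj_def
  by (intro borel_measurable_continuous_onI continuous_on_vec_lambda
        continuous_on_compose2[OF continuous_on_abs_circle[of UNIV]] continuous_intros) auto

text \<open>
  The topology of the circle is the quotient topology, so continuity can be checked after lifting to
  the real line.
\<close>

lemma continuous_on_circle:
  assumes "continuous_on UNIV (\<lambda>x. f (abs_circle x))"
  shows "continuous_on S f"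
proof (rule continuous_on_subset[OF _ subset_UNIV])
  have "open (f -` U)" if "open U" for U
    using open_vimage[OF that assms] by (simp add: open_circle_def vimage_def)
  then show "continuous_on UNIV f" by (simp add: continuous_on_open_vimage)
qed

lemma borel_measurable_torus_zmult [measurable]: "torus_zmult n \<in> borel_measurable borel"
proof -
  have *: "continuous_on UNIV (circle_zmult n)"
    by (rule continuous_on_circle)
       (auto simp: circle_zmult.abs_eq
         intro!: continuous_on_compose2[OF continuous_on_abs_circle[of UNIV]] continuous_intros)
  then show ?thesis unfolding torus_zmult_def
    by (intro borel_measurable_continuous_onI continuous_on_vec_lambda
        continuous_on_compose2[OF *] continuous_intros) auto
qed

lemma borel_measurable_torus_translation [measurable]:
  "(\<lambda>t. t + s) \<in> borel_measurable (borel :: (circle ^ 'k) measure)"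
proof -
  have *: "continuous_on UNIV (\<lambda>t. t + abs_circle y)" for y
    by (rule continuous_on_circle)
       (auto simp: plus_circle.abs_eq
         intro!: continuous_on_compose2[OF continuous_on_abs_circle[of UNIV]] continuous_intros)
  have **: "continuous_on UNIV (\<lambda>t. t + y)" for y :: circle
    using *[of "rep_circle y"] by (simp add: Quotient_abs_rep[OF Quotient_circle])
  have "continuous_on UNIV (\<lambda>t :: circle ^ 'k. \<chi> i. t $ i + s $ i)"
    by (intro continuous_on_vec_lambda continuous_on_compose2[OF **] continuous_intros) auto
  moreover have "(\<lambda>t :: circle ^ 'k. \<chi> i. t $ i + s $ i) = (\<lambda>t. t + s)" by (auto simp: vec_eq_iff)
  ultimately have "continuous_on UNIV (\<lambda>t :: circle ^ 'k. t + s)" by (simp only:)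
  then show ?thesis by (rule borel_measurable_continuous_onI)
qed

lemma unit_cube_borel [measurable]: "unit_cube \<in> sets borel"
  unfolding unit_cube_def by measurable

text \<open>
  Lebesgue measure before completion. The arguments by uniqueness of measures and by Fubini's theorem
  take place here, on Borel sets, and are transferred to the completion afterwards.
\<close>

definition torus_borel :: "(circle ^ 'k) measure" where
  "torus_borel = distr (restrict_space lborel unit_cube) borel torus_proj"

lemma torus_lebesgue_eq: "torus_lebesgue = completion torus_borel"
  by (simp add: torus_lebesgue_def torus_borel_def)

lemma sets_torus_borel [simp, measurable_cong]: "sets torus_borel = sets borel"
  and space_torus_borel [simp]: "space torus_borel = UNIV"
  by (simp_all add: torus_borel_def)

lemma emeasure_torus_borel:
  assumes "E \<in> sets borel"
  shows "emeasure torus_borel E = emeasure lborel {x\<in>unit_cube. torus_proj x \<in> E}"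
proof -
  have "emeasure torus_borel E = emeasure (restrict_space lborel unit_cube)
      (torus_proj -` E \<inter> space (restrict_space lborel unit_cube))"
    unfolding torus_borel_def by (rule emeasure_distr[OF measurable_torus_proj assms])
  also have "\<dots> = emeasure lborel {x\<in>unit_cube. torus_proj x \<in> E}"
    by (subst emeasure_restrict_space)
       (auto simp: space_restrict_space intro!: arg_cong[where f="emeasure lborel"])
  finally show ?thesis .
qed

lemma prob_space_torus_borel: "prob_space (torus_borel :: (circle ^ 'k) measure)"
proof -
  have "emeasure torus_borel (UNIV :: (circle ^ 'k) set) = 1"
    using prob_space.emeasure_space_1[OF prob_space_torus_lebesgue[where 'k='k]]
    by (simp add: torus_lebesgue_eq)
  then show ?thesis by (intro prob_spaceI) simp
qed

lemma nn_integral_torus_borel: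
  assumes [measurable]: "g \<in> borel_measurable borel"
  shows "(\<integral>\<^sup>+t. g t \<partial>torus_borel) = (\<integral>\<^sup>+x. g (torus_proj x) * indicator unit_cube x \<partial>lborel)"
  unfolding torus_borel_def
  by (subst nn_integral_distr[OF measurable_torus_proj]) (auto simp: nn_integral_restrict_space)

definition lattice_vec :: "int ^ 'k \<Rightarrow> real ^ 'k" where
  "lattice_vec v = (\<chi> i. of_int (v $ i))"

lemma torus_proj_lattice_shift: "torus_proj (x + lattice_vec v) = torus_proj x"
  by (simp add: torus_proj_eq_iff lattice_vec_def)

text \<open>
  The translates of the unit cube by integer vectors tile space.
\<close>

lemma unit_cube_tiling:
  "(\<integral>\<^sup>+v. indicator unit_cube (x + lattice_vec v) \<partial>count_space UNIV) = (1 :: ennreal)"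
proof -
  let ?v = "\<chi> i. - \<lfloor>x $ i\<rfloor>"
  have "x + lattice_vec v \<in> unit_cube \<longleftrightarrow> v = ?v" for v
  proof -
    have "0 \<le> x $ i + of_int (v $ i) \<and> x $ i + of_int (v $ i) < 1 \<longleftrightarrow> v $ i = - \<lfloor>x $ i\<rfloor>" for i
      by linarith
    then show ?thesis by (simp add: unit_cube_def lattice_vec_def vec_eq_iff)
  qed
  then have "indicator unit_cube (x + lattice_vec v) = (indicator {?v} v :: ennreal)" for v
    by (simp add: indicator_def)
  then show ?thesis by simp
qed

text \<open>
  Translating by \<open>s\<close> replaces the unit cube by another fundamental domain of the lattice. Cutting both
  domains along each other with the tiling and moving the pieces by lattice vectors, which
  does not change the periodic integrand, shows that the integrals over them agree.
\<close>

lemma nn_integral_torus_translate: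
  assumes [measurable]: "g \<in> borel_measurable borel"
  shows "(\<integral>\<^sup>+t. g (t + s) \<partial>torus_borel) = (\<integral>\<^sup>+t. g t \<partial>torus_borel)"
proof -
  obtain y where y: "torus_proj y = s" using torus_proj_surj by blast
  let ?h = "\<lambda>x. g (torus_proj x)"
  let ?I = "indicator unit_cube :: _ \<Rightarrow> ennreal"
  have shift: "(\<integral>\<^sup>+x. f (c + x) \<partial>lborel) = (\<integral>\<^sup>+x. f x \<partial>lborel)"
    if [measurable]: "f \<in> borel_measurable borel" for f :: "real ^ 'a \<Rightarrow> ennreal" and c
    by (subst (2) lborel_distr_plus[of c, symmetric]) (simp add: nn_integral_distr)
  have "(\<integral>\<^sup>+t. g (t + s) \<partial>torus_borel) = (\<integral>\<^sup>+x. ?h (y + x) * ?I (- y + (y + x)) \<partial>lborel)"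
    by (simp add: nn_integral_torus_borel torus_proj_add y add.commute)
  also have "\<dots> = (\<integral>\<^sup>+x. ?h x * ?I (- y + x) \<partial>lborel)"
    by (rule shift) measurable
  also have "\<dots> = (\<integral>\<^sup>+x. \<integral>\<^sup>+v. ?h x * ?I (- y + x) * ?I (x + lattice_vec v) \<partial>count_space UNIV \<partial>lborel)"
    by (simp add: nn_integral_cmult unit_cube_tiling)
  also have "\<dots> = (\<integral>\<^sup>+v. \<integral>\<^sup>+x. ?h x * ?I (- y + x) * ?I (x + lattice_vec v) \<partial>lborel \<partial>count_space UNIV)"
    by (rule nn_integral_count_space_nn_integral) auto
  also have "\<dots> = (\<integral>\<^sup>+v. \<integral>\<^sup>+x. ?h x * ?I (- y + x - lattice_vec v) * ?I x \<partial>lborel \<partial>count_space UNIV)"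
  proof (rule nn_integral_cong)
    fix v :: "int ^ 'a"
    have "(\<integral>\<^sup>+x. ?h x * ?I (- y + x) * ?I (x + lattice_vec v) \<partial>lborel)
      = (\<integral>\<^sup>+x. ?h (lattice_vec v + x) * ?I (- y + (lattice_vec v + x) - lattice_vec v)
          * ?I (lattice_vec v + x) \<partial>lborel)"
      by (simp add: torus_proj_lattice_shift add.commute[of "lattice_vec v"])
    also have "\<dots> = (\<integral>\<^sup>+x. ?h x * ?I (- y + x - lattice_vec v) * ?I x \<partial>lborel)"
      by (rule shift) measurable
    finally show "(\<integral>\<^sup>+x. ?h x * ?I (- y + x) * ?I (x + lattice_vec v) \<partial>lborel) = \<dots>" .
  qed
  also have "\<dots> = (\<integral>\<^sup>+x. \<integral>\<^sup>+v. ?h x * ?I (- y + x - lattice_vec v) * ?I x \<partial>count_space UNIV \<partial>lborel)"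
    by (rule nn_integral_count_space_nn_integral[symmetric]) auto
  also have "\<dots> = (\<integral>\<^sup>+x. ?h x * ?I x \<partial>lborel)"
  proof (rule nn_integral_cong)
    fix x :: "real ^ 'a"
    have "(\<integral>\<^sup>+v. ?I (- y + x - lattice_vec v) \<partial>count_space UNIV)
       = (\<integral>\<^sup>+v. ?I (- y + x - lattice_vec (- v)) \<partial>count_space UNIV)"
      by (rule nn_integral_bij_count_space[symmetric]) (auto intro: bij_uminus)
    also have "\<dots> = 1"
    proof -
      have "lattice_vec (- v) = - lattice_vec v" for v :: "int ^ 'a"
        by (simp add: lattice_vec_def vec_eq_iff)
      then show ?thesis by (simp add: unit_cube_tiling)
    qed
    finally show "(\<integral>\<^sup>+v. ?h x * ?I (- y + x - lattice_vec v) * ?I x \<partial>count_space UNIV) = ?h x * ?I x"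
      by (simp add: nn_integral_cmult nn_integral_multc)
  qed
  finally show ?thesis by (simp add: nn_integral_torus_borel)
qed

lemma emeasure_torus_translate:
  assumes [measurable]: "E \<in> sets borel"
  shows "emeasure torus_borel {t. t + s \<in> E} = emeasure torus_borel E"
proof -
  have [measurable]: "{t. t + s \<in> E} \<in> sets borel" by measurable
  have "emeasure torus_borel {t. t + s \<in> E} = (\<integral>\<^sup>+t. indicator {t. t + s \<in> E} t \<partial>torus_borel)"
    by simp
  also have "\<dots> = (\<integral>\<^sup>+t. indicator E (t + s) \<partial>torus_borel)"
    by (intro nn_integral_cong) (simp add: indicator_def)
  finally show ?thesis by (simp add: nn_integral_torus_translate)
qed

text \<open>
  The image of Lebesgue measure under multiplication by \<open>q\<close> is again translation invariant, because
  every translation of the torus is covered by a translation by a \<open>q\<close>-th part. Averaging over all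
  translations and applying Fubini's theorem identifies it with Lebesgue measure, as in the proof
  that Haar measure is unique.
\<close>

lemma emeasure_torus_zmult:
  assumes [measurable]: "E \<in> sets borel" and q: "q \<noteq> 0"
  shows "emeasure torus_borel {t. torus_zmult q t \<in> E} = emeasure torus_borel (E :: (circle ^ 'k) set)"
proof -
  let ?T = "torus_borel :: (circle ^ 'k) measure"
  let ?C = "restrict_space lborel unit_cube :: (real ^ 'k) measure"
  let ?h = "\<lambda>x. indicator E (torus_proj x) :: ennreal"
  have T: "(\<integral>\<^sup>+x. g (torus_proj x) \<partial>?C) = (\<integral>\<^sup>+t. g t \<partial>?T)" if "g \<in> borel_measurable borel" for g
    unfolding torus_borel_def by (simp add: that nn_integral_distr[OF measurable_torus_proj])
  have "emeasure ?C (space ?C) = 1"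
    using prob_space.emeasure_space_1[OF prob_space_torus_borel[where 'k='k]]
    by (simp add: emeasure_torus_borel emeasure_restrict_space space_restrict_space)
  then interpret C: prob_space ?C by (rule prob_spaceI)
  interpret CC: pair_sigma_finite ?C ?C ..
  have id[measurable]: "(\<lambda>x. x) \<in> ?C \<rightarrow>\<^sub>M borel" by (simp add: measurable_restrict_space1)
  have [measurable]: "{t. torus_zmult q t \<in> E} \<in> sets borel" by measurable
  let ?m = "emeasure ?T {t. torus_zmult q t \<in> E}"
  have *: "?m = (\<integral>\<^sup>+x. ?h (of_int q *\<^sub>R x + y) \<partial>?C)" for y
  proof -
    \<comment> \<open>Translating by a \<open>q\<close>-th part of \<open>y\<close> before the multiplication produces the shift by \<open>y\<close> after it.\<close>
    define s where "s = torus_proj (y /\<^sub>R of_int q)"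
    have "?m = (\<integral>\<^sup>+t. indicator {t. torus_zmult q t \<in> E} t \<partial>?T)" by simp
    also have "\<dots> = (\<integral>\<^sup>+t. indicator E (torus_zmult q t) \<partial>?T)"
      by (intro nn_integral_cong) (simp add: indicator_def)
    also have "\<dots> = (\<integral>\<^sup>+t. indicator E (torus_zmult q (t + s)) \<partial>?T)"
      by (rule nn_integral_torus_translate[symmetric]) measurable
    also have "\<dots> = (\<integral>\<^sup>+x. indicator E (torus_zmult q (torus_proj x + s)) \<partial>?C)"
      by (rule T[symmetric]) measurable
    also have "\<dots> = (\<integral>\<^sup>+x. ?h (of_int q *\<^sub>R x + y) \<partial>?C)"
    proof (rule nn_integral_cong)
      fix x
      have "torus_zmult q (torus_proj x + s) = torus_proj (of_int q *\<^sub>R (x + y /\<^sub>R of_int q))"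
        by (simp add: s_def flip: torus_proj_add torus_proj_zmult)
      also have "of_int q *\<^sub>R (x + y /\<^sub>R of_int q) = of_int q *\<^sub>R x + y"
        using q by (simp add: scaleR_add_right)
      finally show "indicator E (torus_zmult q (torus_proj x + s)) = ?h (of_int q *\<^sub>R x + y)" by simp
    qed
    finally show ?thesis .
  qed
  have "?m = (\<integral>\<^sup>+y. ?m \<partial>?C)" by (simp only: nn_integral_const C.emeasure_space_1 mult_1_right)
  also have "\<dots> = (\<integral>\<^sup>+y. \<integral>\<^sup>+x. ?h (of_int q *\<^sub>R x + y) \<partial>?C \<partial>?C)" using * by (intro nn_integral_cong) simp
  also have "\<dots> = (\<integral>\<^sup>+x. \<integral>\<^sup>+y. ?h (of_int q *\<^sub>R x + y) \<partial>?C \<partial>?C)"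
    by (rule CC.Fubini') measurable
  also have "\<dots> = (\<integral>\<^sup>+x. emeasure ?T E \<partial>?C)"
  proof (rule nn_integral_cong)
    fix x
    have "(\<integral>\<^sup>+y. ?h (of_int q *\<^sub>R x + y) \<partial>?C)
        = (\<integral>\<^sup>+y. indicator E (torus_proj y + torus_proj (of_int q *\<^sub>R x)) \<partial>?C)"
      by (simp add: torus_proj_add add.commute)
    also have "\<dots> = (\<integral>\<^sup>+t. indicator E (t + torus_proj (of_int q *\<^sub>R x)) \<partial>?T)"
      by (rule T) measurable
    also have "\<dots> = emeasure ?T E"
      by (subst nn_integral_torus_translate) auto
    finally show "(\<integral>\<^sup>+y. ?h (of_int q *\<^sub>R x + y) \<partial>?C) = emeasure ?T E" .
  qed
  also have "\<dots> = emeasure ?T E" by (simp only: nn_integral_const C.emeasure_space_1 mult_1_right)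
  finally show ?thesis .
qed

section \<open>Approach of the multiples of a generic point to zero\<close>

text \<open>
  The cube is half-open so that multiplication by \<open>q\<close> maps it bijectively onto the whole torus.
\<close>

definition small_cube :: "int \<Rightarrow> (circle ^ 'k) set" where
  "small_cube q = {t. \<forall>i. t $ i \<in> abs_circle ` {0..<1 / of_int q}}"

text \<open>
  The half-open arc is an open arc together with the point \<open>0\<close>, which is closed because the integers
  are closed in the real line.
\<close>

lemma small_cube_borel [measurable]: "small_cube q \<in> sets borel"
proof -
  have "open (abs_circle ` {0<..<1 / of_int q})"
  proof -
    have "abs_circle -` abs_circle ` {0<..<1 / of_int q} = (\<Union>n::int. {of_int n<..<of_int n + 1 / of_int q})"
    proof (intro equalityI subsetI)
      fix x :: real assume "x \<in> abs_circle -` abs_circle ` {0<..<1 / of_int q}"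
      then obtain y and n :: int where "y \<in> {0<..<1 / of_int q}" "x - y = of_int n"
        by (auto simp: abs_circle_eq_iff elim!: Ints_cases)
      then show "x \<in> (\<Union>n::int. {of_int n<..<of_int n + 1 / of_int q})"
        by (intro UN_I[of n]) (auto simp: algebra_simps)
    next
      fix x :: real assume "x \<in> (\<Union>n::int. {of_int n<..<of_int n + 1 / of_int q})"
      then obtain n :: int where "x - of_int n \<in> {0<..<1 / of_int q}" by (auto simp: algebra_simps)
      then show "x \<in> abs_circle -` abs_circle ` {0<..<1 / of_int q}"
        by (intro vimageI2 image_eqI[of _ _ "x - of_int n"]) (auto simp: abs_circle_eq_iff)
    qed
    then show ?thesis by (simp add: open_circle_def open_UN)
  qed
  moreover have "closed {0 :: circle}"
  proof -
    have "abs_circle -` (- {0}) = - \<int>"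
      by (auto simp: zero_circle_def abs_circle_eq_iff)
    moreover have "open (- \<int> :: real set)" by (intro open_Compl closed_Ints)
    ultimately show ?thesis by (simp add: closed_def open_circle_def)
  qed
  moreover have "{0..<r} = (if r > 0 then insert 0 {0<..<r} else {})" for r :: real by auto
  then have "abs_circle ` {0..<r} = (if r > 0 then insert 0 (abs_circle ` {0<..<r}) else {})" for r
    by (simp add: zero_circle_def)
  ultimately have "abs_circle ` {0..<1 / of_int q} \<in> sets borel"
    by (auto intro: sets.insert_in_sets)
  moreover have "(\<lambda>t :: circle ^ 'a. t $ i) \<in> borel_measurable borel" for i
    by (intro borel_measurable_continuous_onI continuous_intros)
  ultimately show ?thesis
    unfolding small_cube_def by measurable
qed

lemma small_cube_lift:
  assumes "t \<in> small_cube q"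
  shows "\<exists>x. torus_proj x = t \<and> (\<forall>i. 0 \<le> x $ i \<and> x $ i < 1 / of_int q)"
proof -
  from assms have "\<forall>i. \<exists>y. t $ i = abs_circle y \<and> y \<in> {0..<1 / of_int q}"
    unfolding small_cube_def by blast
  then obtain f where "\<And>i. t $ i = abs_circle (f i)" "\<And>i. f i \<in> {0..<1 / of_int q}" by metis
  then show ?thesis
    by (intro exI[of _ "\<chi> i. f i"]) (auto simp: torus_proj_def vec_eq_iff)
qed

lemma torus_proj_in_small_cube_iff:
  assumes "x \<in> unit_cube" and q: "q \<ge> 1"
  shows "torus_proj x \<in> small_cube q \<longleftrightarrow> of_int q *\<^sub>R x \<in> unit_cube"
proof -
  have "abs_circle (x $ i) \<in> abs_circle ` {0..<1 / of_int q} \<longleftrightarrow> of_int q * x $ i \<in> {0..<1}" for i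
  proof -
    have q0: "of_int q > (0::real)" using q by simp
    have x: "0 \<le> x $ i" "x $ i < 1" using assms by (auto simp: unit_cube_def)
    have "x $ i = y" if "0 \<le> y" "y < 1 / of_int q" "x $ i - y \<in> \<int>" for y
    proof -
      have "1 / of_int q \<le> (1::real)" using q by simp
      with that x have "\<bar>x $ i - y\<bar> < 1" by linarith
      then show ?thesis using \<open>x $ i - y \<in> \<int>\<close> Ints_nonzero_abs_less1 by force
    qed
    then have "abs_circle (x $ i) \<in> abs_circle ` {0..<1 / of_int q} \<longleftrightarrow> x $ i \<in> {0..<1 / of_int q}"
      by (fastforce simp: abs_circle_eq_iff)
    then show ?thesis using q0 x by (simp add: field_simps)
  qed
  then show ?thesis
    by (auto simp: small_cube_def torus_proj_def unit_cube_def)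
qed

text \<open>
  On the small cube, multiplication by \<open>q\<close> is a dilation onto the torus, so the points of the cube
  that it sends to \<open>E\<close> form a copy of \<open>E\<close> scaled down by \<open>q\<close>. Since the cube has
  measure \<open>1 / q ^ CARD('k)\<close>, this says that visiting the cube now is independent of all later visits.
\<close>

lemma emeasure_small_cube_zmult:
  assumes [measurable]: "E \<in> sets borel" and q: "q \<ge> 1"
  shows "emeasure torus_borel {t \<in> small_cube q. torus_zmult q t \<in> E}
      = ennreal (1 / of_int q ^ CARD('k)) * emeasure torus_borel (E :: (circle ^ 'k) set)"
proof -
  let ?A = "{x \<in> unit_cube. torus_proj x \<in> E}"
  have [measurable]: "?A \<in> sets borel" by measurable
  have q0: "of_int q > (0::real)" using q by simp
  have "emeasure torus_borel {t \<in> small_cube q. torus_zmult q t \<in> E}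
     = emeasure lborel {x \<in> unit_cube. torus_proj x \<in> small_cube q \<and> torus_zmult q (torus_proj x) \<in> E}"
    by (subst emeasure_torus_borel) auto
  also have "{x \<in> unit_cube. torus_proj x \<in> small_cube q \<and> torus_zmult q (torus_proj x) \<in> E}
     = {x. of_int q *\<^sub>R x \<in> ?A}"
  proof -
    have "x \<in> unit_cube" if "of_int q *\<^sub>R x \<in> unit_cube" for x
    proof -
      have "0 \<le> x $ i \<and> x $ i < 1" for i
      proof -
        have *: "0 \<le> of_int q * x $ i" "of_int q * x $ i < 1" using that by (auto simp: unit_cube_def)
        then have "0 \<le> x $ i" using q0 by (simp add: zero_le_mult_iff)
        moreover then have "x $ i \<le> of_int q * x $ i" using q by (simp add: mult_le_cancel_right1)
        ultimately show ?thesis using * by linarith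
      qed
      then show ?thesis by (simp add: unit_cube_def)
    qed
    then show ?thesis using q by (auto simp: torus_proj_in_small_cube_iff torus_proj_zmult)
  qed
  also have "emeasure lborel \<dots> = ennreal (1 / of_int q ^ CARD('k)) * emeasure lborel ?A"
  proof -
    have "emeasure lborel ?A = of_int q ^ CARD('k) * emeasure lborel {x. of_int q *\<^sub>R x \<in> ?A}"
      using q0 by (subst lborel_affine[of "of_int q" 0])
        (auto simp: emeasure_density nn_integral_cmult emeasure_distr vimage_def
           nn_integral_cmult_indicator ennreal_power)
    then show ?thesis using q0
      by (simp add: mult.assoc[symmetric] ennreal_mult[symmetric] ennreal_power)
  qed
  finally show ?thesis by (simp add: emeasure_torus_borel)
qed

text \<open>
  The scaling relation of the factors carries over to the product: both sides are finite measures
  in \<open>A\<close>, and they agree on measurable boxes. With \<open>W = space M\<close> and \<open>c = 1\<close> this says that a product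
  of measure-preserving maps preserves the product measure.
\<close>

lemma emeasure_PiM_coordinatewise:
  fixes M :: "'a measure" and c :: ennreal
  assumes "finite I" "prob_space M" and S[measurable]: "S \<in> M \<rightarrow>\<^sub>M M" and W[measurable]: "W \<in> sets M"
    and c: "\<And>E. E \<in> sets M \<Longrightarrow> emeasure M {x \<in> W. S x \<in> E} = c * emeasure M E"
    and A: "A \<in> sets (PiM I (\<lambda>_. M))"
  shows "emeasure (PiM I (\<lambda>_. M)) {x \<in> Pi\<^sub>E I (\<lambda>_. W). (\<lambda>i\<in>I. S (x i)) \<in> A}
      = c ^ card I * emeasure (PiM I (\<lambda>_. M)) A"
proof -
  interpret M: prob_space M by fact
  interpret P: product_prob_space "\<lambda>_. M" I by standard
  let ?P = "PiM I (\<lambda>_. M)"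
  let ?W = "Pi\<^sub>E I (\<lambda>_. W)" and ?F = "\<lambda>x. \<lambda>i\<in>I. S (x i)"
  have F[measurable]: "?F \<in> ?P \<rightarrow>\<^sub>M ?P" by measurable
  have W'[measurable]: "?W \<in> sets ?P" using \<open>finite I\<close> by (intro sets_PiM_I_finite) auto
  have WS: "?W \<subseteq> space ?P" by (rule sets.sets_into_space[OF W'])
  have eD: "emeasure (distr (density ?P (indicator ?W)) ?P ?F) E = emeasure ?P {x \<in> ?W. ?F x \<in> E}"
    if [measurable]: "E \<in> sets ?P" for E
  proof -
    have set_eq: "{x \<in> ?W. ?F x \<in> E} = ?W \<inter> (?F -` E \<inter> space ?P)" using WS by blast
    have "emeasure (distr (density ?P (indicator ?W)) ?P ?F) E
        = emeasure (density ?P (indicator ?W)) (?F -` E \<inter> space ?P)"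
      by (subst emeasure_distr) auto
    also have "\<dots> = (\<integral>\<^sup>+x. indicator ?W x * indicator (?F -` E \<inter> space ?P) x \<partial>?P)"
      by (rule emeasure_density) measurable
    also have "\<dots> = (\<integral>\<^sup>+x. indicator (?W \<inter> (?F -` E \<inter> space ?P)) x \<partial>?P)"
      by (simp only: indicator_inter_arith)
    also have "\<dots> = emeasure ?P (?W \<inter> (?F -` E \<inter> space ?P))"
      by (rule nn_integral_indicator) measurable
    finally show ?thesis unfolding set_eq .
  qed
  have "distr (density ?P (indicator ?W)) ?P ?F = scale_measure (c ^ card I) ?P"
  proof (rule measure_eqI_PiM_finite[where I = I and M = "\<lambda>_. M" and A = "\<lambda>_. space ?P"])
    fix E assume E: "\<And>i. i \<in> I \<Longrightarrow> E i \<in> sets M"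
    have EP: "Pi\<^sub>E I E \<in> sets ?P" using E \<open>finite I\<close> by (intro sets_PiM_I_finite) auto
    have "{x \<in> ?W. ?F x \<in> Pi\<^sub>E I E} = Pi\<^sub>E I (\<lambda>i. {x \<in> W. S x \<in> E i})"
      by (auto simp: PiE_iff extensional_def)
    moreover have "{x \<in> W. S x \<in> E i} \<in> sets M" if "i \<in> I" for i
    proof -
      have "{x \<in> W. S x \<in> E i} = W \<inter> (S -` E i \<inter> space M)"
        using sets.sets_into_space[OF W] by auto
      then show ?thesis using measurable_sets[OF S E[OF that]] by auto
    qed
    ultimately have "emeasure ?P {x \<in> ?W. ?F x \<in> Pi\<^sub>E I E} = (\<Prod>i\<in>I. c * emeasure M (E i))"
      using \<open>finite I\<close> E by (simp add: P.emeasure_PiM c)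
    also have "\<dots> = c ^ card I * emeasure ?P (Pi\<^sub>E I E)"
      using \<open>finite I\<close> E by (simp add: P.emeasure_PiM prod.distrib)
    finally show "emeasure (distr (density ?P (indicator ?W)) ?P ?F) (Pi\<^sub>E I E)
        = emeasure (scale_measure (c ^ card I) ?P) (Pi\<^sub>E I E)"
      by (simp add: eD EP)
  next
    have "emeasure ?P {x \<in> ?W. ?F x \<in> space ?P} \<le> emeasure ?P ?W"
      by (intro emeasure_mono) auto
    then show "emeasure (distr (density ?P (indicator ?W)) ?P ?F) (space ?P) \<noteq> \<infinity>"
      using P.emeasure_finite[of ?W] by (auto simp: eD top_unique)
    show "range (\<lambda>_. space ?P) \<subseteq> prod_algebra I (\<lambda>_. M)"
      using \<open>finite I\<close> by (auto simp: space_PiM prod_algebra_eq_finite)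
  qed (use \<open>finite I\<close> in auto)
  then show ?thesis using eD[OF A] by simp
qed

lemma torus_zmult_mult: "torus_zmult m (torus_zmult n t) = torus_zmult (m * n) t"
proof -
  obtain x where "t = torus_proj x" using torus_proj_surj by metis
  then show ?thesis by (simp flip: torus_proj_zmult)
qed

lemma torus_zmult_1: "torus_zmult 1 t = t"
proof -
  obtain x where "t = torus_proj x" using torus_proj_surj by metis
  then show ?thesis using torus_proj_zmult[of 1 x] by simp
qed

lemma torus_zmult_add: "torus_zmult (m + n) t = torus_zmult m t + torus_zmult n t"
proof -
  obtain x where "t = torus_proj x" using torus_proj_surj by metis
  then show ?thesis by (simp add: scaleR_add_left flip: torus_proj_zmult torus_proj_add)
qed

text \<open>
  Let \<open>N\<close> be the set of points whose orbit under multiplication by \<open>q\<close> never visits the product of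
  small cubes. A point lies in \<open>N\<close> if and only if it is outside the product and its image lies in \<open>N\<close>.
  The preimage of \<open>N\<close> has the same measure as \<open>N\<close>, so the part of that preimage inside the
  product is a null set. That part has measure \<open>c\<close> times the measure of \<open>N\<close> for a
  positive constant \<open>c\<close>, hence \<open>N\<close> is a null set too.
\<close>

lemma AE_orbit_meets_small_cube:
  assumes q: "q \<ge> 1"
  shows "AE \<alpha> in PiM (UNIV :: 'd::finite set) (\<lambda>_. torus_borel :: (circle ^ 'k) measure).
           \<exists>j. \<forall>d. torus_zmult (q ^ j) (\<alpha> d) \<in> small_cube q"
proof -
  let ?P = "PiM (UNIV :: 'd set) (\<lambda>_. torus_borel :: (circle ^ 'k) measure)"
  interpret T: prob_space "torus_borel :: (circle ^ 'k) measure" by (rule prob_space_torus_borel)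
  interpret P: product_prob_space "\<lambda>_. torus_borel :: (circle ^ 'k) measure" "UNIV :: 'd set" by standard
  have space: "space ?P = UNIV" by (simp add: space_PiM)
  define N where "N = {\<alpha> :: 'd \<Rightarrow> circle ^ 'k. \<forall>j. \<exists>d. torus_zmult (q ^ j) (\<alpha> d) \<notin> small_cube q}"
  define F where "F \<alpha> d = torus_zmult q (\<alpha> d)" for \<alpha> :: "'d \<Rightarrow> circle ^ 'k" and d
  have N[measurable]: "N \<in> sets ?P"
  proof -
    have "N = {\<alpha> \<in> space ?P. \<forall>j. \<exists>d\<in>UNIV. torus_zmult (q ^ j) (\<alpha> d) \<notin> small_cube q}"
      by (auto simp: N_def space)
    also have "\<dots> \<in> sets ?P" by measurable
    finally show ?thesis .
  qed
  have scaling: "emeasure ?P {\<alpha>. (\<forall>d. \<alpha> d \<in> W) \<and> F \<alpha> \<in> N} = c ^ CARD('d) * emeasure ?P N"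
    if "W \<in> sets borel" and
      "\<And>E. E \<in> sets borel \<Longrightarrow> emeasure torus_borel {t \<in> W. torus_zmult q t \<in> E} = c * emeasure torus_borel E"
    for W c
    using emeasure_PiM_coordinatewise[of "UNIV :: 'd set" torus_borel "torus_zmult q" W c N] that N
      T.prob_space_axioms
    by (simp add: F_def[abs_def] PiE_UNIV_domain Pi_iff restrict_UNIV)
  have "emeasure ?P {\<alpha>. (\<forall>d. \<alpha> d \<in> UNIV) \<and> F \<alpha> \<in> N} = 1 ^ CARD('d) * emeasure ?P N"
    by (rule scaling) (use q in \<open>auto simp: emeasure_torus_zmult\<close>)
  then have inv: "emeasure ?P {\<alpha>. F \<alpha> \<in> N} = emeasure ?P N" by simp
  let ?c = "ennreal (1 / of_int q ^ CARD('k)) ^ CARD('d)"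
  have cN: "emeasure ?P {\<alpha>. (\<forall>d. \<alpha> d \<in> small_cube q) \<and> F \<alpha> \<in> N} = ?c * emeasure ?P N"
    by (rule scaling) (use q in \<open>auto simp: emeasure_small_cube_zmult\<close>)
  have Fj: "torus_zmult (q ^ j) (F \<alpha> d) = torus_zmult (q ^ Suc j) (\<alpha> d)" for j \<alpha> d
    by (simp add: F_def torus_zmult_mult mult.commute)
  have NF: "\<alpha> \<in> N \<longleftrightarrow> \<not> (\<forall>d. \<alpha> d \<in> small_cube q) \<and> F \<alpha> \<in> N" for \<alpha>
  proof -
    have "(\<forall>j. Q j) \<longleftrightarrow> Q 0 \<and> (\<forall>j. Q (Suc j))" for Q :: "nat \<Rightarrow> bool" by (metis not0_implies_Suc)
    from this[of "\<lambda>j. \<exists>d. torus_zmult (q ^ j) (\<alpha> d) \<notin> small_cube q"]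
    show ?thesis unfolding N_def mem_Collect_eq Fj by (simp add: torus_zmult_1)
  qed
  have meas: "{\<alpha>. (\<forall>d. \<alpha> d \<in> small_cube q) \<and> F \<alpha> \<in> N} \<in> sets ?P"
  proof -
    have [measurable]: "F \<in> ?P \<rightarrow>\<^sub>M ?P"
      unfolding F_def[abs_def] by (rule measurable_PiM_single') (auto simp: space)
    have "{\<alpha>. (\<forall>d. \<alpha> d \<in> small_cube q) \<and> F \<alpha> \<in> N} = {\<alpha> \<in> space ?P. (\<forall>d\<in>UNIV. \<alpha> d \<in> small_cube q) \<and> F \<alpha> \<in> N}"
      by (auto simp: space)
    also have "\<dots> \<in> sets ?P" by measurable
    finally show ?thesis .
  qed
  have "emeasure ?P N + ?c * emeasure ?P N = emeasure ?P (N \<union> {\<alpha>. (\<forall>d. \<alpha> d \<in> small_cube q) \<and> F \<alpha> \<in> N})"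
    unfolding cN[symmetric]
  proof (rule plus_emeasure[OF N meas])
    show "N \<inter> {\<alpha>. (\<forall>d. \<alpha> d \<in> small_cube q) \<and> F \<alpha> \<in> N} = {}" using NF by blast
  qed
  also have "N \<union> {\<alpha>. (\<forall>d. \<alpha> d \<in> small_cube q) \<and> F \<alpha> \<in> N} = {\<alpha>. F \<alpha> \<in> N}"
    using NF by blast
  finally have "emeasure ?P N + ?c * emeasure ?P N = emeasure ?P N + 0" by (simp add: inv)
  then have "?c * emeasure ?P N = 0"
    using P.emeasure_finite[of N] by (simp add: ennreal_add_left_cancel)
  moreover have "?c \<noteq> 0" using q by (simp add: ennreal_power)
  ultimately have "emeasure ?P N = 0" by simp
  then show ?thesis using N by (intro AE_I[of _ _ N]) (auto simp: N_def)
qed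

text \<open>
  The identity map from the product of the completions to the product of the original measures is
  measure preserving, so null sets of the latter pull back to null sets.
\<close>

lemma AE_PiM_completion:
  assumes "finite I" "prob_space M" and "AE x in PiM I (\<lambda>_. M). Q x"
  shows "AE x in PiM I (\<lambda>_. completion M). Q x"
proof -
  have id: "(\<lambda>x. x) \<in> completion M \<rightarrow>\<^sub>M M" by (rule measurable_completion) simp
  have "distr (PiM I (\<lambda>_. completion M)) (PiM I (\<lambda>_. M)) (compose I (\<lambda>x. x))
      = PiM I (\<lambda>_. distr (completion M) M (\<lambda>x. x))"
    using assms id by (intro distr_PiM_finite_prob_space') (auto intro: prob_space.prob_space_completion)
  also have "distr (completion M) M (\<lambda>x. x) = M"
    by (subst distr_completion) (auto simp: distr_id2)
  finally have eq: "distr (PiM I (\<lambda>_. completion M)) (PiM I (\<lambda>_. M)) (compose I (\<lambda>x. x)) = PiM I (\<lambda>_. M)" .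
  have "compose I (\<lambda>x. x) \<in> PiM I (\<lambda>_. completion M) \<rightarrow>\<^sub>M PiM I (\<lambda>_. M)"
    unfolding compose_def by (intro measurable_restrict measurable_compose[OF _ id]) measurable
  moreover have "AE x in distr (PiM I (\<lambda>_. completion M)) (PiM I (\<lambda>_. M)) (compose I (\<lambda>x. x)). Q x"
    unfolding eq by (rule assms(3))
  ultimately have "AE x in PiM I (\<lambda>_. completion M). Q (compose I (\<lambda>x. x) x)"
    by (rule AE_distrD)
  moreover have "compose I (\<lambda>x. x) x = x" if "x \<in> space (PiM I (\<lambda>_. completion M))" for x
    using that by (auto simp: space_PiM compose_def PiE_iff extensional_def restrict_def fun_eq_iff)
  ultimately show ?thesis by (simp cong: AE_cong_simp)
qed

text \<open>
  Apply the recurrence to all \<open>q = p ^ m\<close>: the powers of such a \<open>q\<close> are powers of \<open>p\<close>.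
\<close>

lemma AE_multiples_approach_0:
  assumes "p \<ge> 2"
  shows "AE \<alpha> in PiM (UNIV :: 'd::finite set) (\<lambda>_. torus_lebesgue :: (circle ^ 'k) measure).
           \<forall>m. \<exists>n. \<forall>d. torus_zmult (int (p ^ n)) (\<alpha> d) \<in> small_cube (int (p ^ m))"
proof -
  have "AE \<alpha> in PiM (UNIV :: 'd::finite set) (\<lambda>_. torus_lebesgue :: (circle ^ 'k) measure).
           \<exists>n. \<forall>d. torus_zmult (int (p ^ n)) (\<alpha> d) \<in> small_cube (int (p ^ m))" for m
  proof -
    have "AE \<alpha> in PiM (UNIV :: 'd::finite set) (\<lambda>_. torus_lebesgue :: (circle ^ 'k) measure).
           \<exists>j. \<forall>d. torus_zmult (int (p ^ m) ^ j) (\<alpha> d) \<in> small_cube (int (p ^ m))"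
      unfolding torus_lebesgue_eq using assms
      by (intro AE_PiM_completion prob_space_torus_borel AE_orbit_meets_small_cube)
         (auto simp flip: of_nat_power)
    then show ?thesis
      by eventually_elim (metis of_nat_power power_mult)
  qed
  then show ?thesis by (simp add: AE_all_countable)
qed

section \<open>Continuity of translation in measure\<close>

text \<open>
  Translations preserve Borel null sets, so they stay measurable and measure preserving on the
  completion.
\<close>

lemma measurable_torus_lebesgue_translation [measurable]:
  "(\<lambda>t. t + s) \<in> torus_lebesgue \<rightarrow>\<^sub>M torus_lebesgue"
  and emeasure_torus_lebesgue_translation:
  "E \<in> sets torus_lebesgue \<Longrightarrow> emeasure torus_lebesgue {t. t + s \<in> E} = emeasure torus_lebesgue E"
proof -
  let ?T = "\<lambda>t. t + s"
  have [measurable]: "?T \<in> torus_borel \<rightarrow>\<^sub>M torus_borel" by measurable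
  have "distr torus_borel torus_borel ?T = torus_borel"
    by (rule measure_eqI) (auto simp: emeasure_distr vimage_def emeasure_torus_translate)
  then have d: "distr torus_lebesgue torus_borel ?T = torus_borel"
    by (simp add: torus_lebesgue_eq distr_completion)
  have m: "?T \<in> torus_lebesgue \<rightarrow>\<^sub>M torus_borel"
    unfolding torus_lebesgue_eq by (rule measurable_completion) measurable
  have m2: "?T \<in> torus_lebesgue \<rightarrow>\<^sub>M torus_lebesgue"
    using completion.measurable_completion2[of ?T torus_borel torus_borel] m d
    by (simp add: torus_lebesgue_eq)
  then show "?T \<in> torus_lebesgue \<rightarrow>\<^sub>M torus_lebesgue" .
  have "distr torus_lebesgue torus_lebesgue ?T = torus_lebesgue"
    using completion.completion_distr_eq[of ?T torus_borel torus_borel] m d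
    by (simp add: torus_lebesgue_eq)
  moreover assume "E \<in> sets torus_lebesgue"
  ultimately have "emeasure torus_lebesgue E = emeasure torus_lebesgue (?T -` E \<inter> space torus_lebesgue)"
    using emeasure_distr[OF m2] by metis
  then show "emeasure torus_lebesgue {t. t + s \<in> E} = emeasure torus_lebesgue E"
    by (simp add: vimage_def torus_lebesgue_eq)
qed

lemma space_torus_lebesgue [simp]: "space torus_lebesgue = UNIV"
  by (simp add: torus_lebesgue_eq)

lemma borel_sets_torus_lebesgue: "E \<in> sets borel \<Longrightarrow> E \<in> sets torus_lebesgue"
  by (simp add: torus_lebesgue_eq)

text \<open>
  Squeeze the part \<open>A\<close> of the lifted set in the unit cube between a compact set \<open>K\<close> and an open
  set \<open>V\<close>. A short translation moves \<open>K\<close> into \<open>V\<close>, so a point of \<open>A\<close> can only leave \<open>A\<close> if it lies in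
  \<open>A - K\<close> or arrives in \<open>V - A\<close>, and both sets have small measure.
\<close>

lemma borel_set_almost_translation_invariant:
  fixes E :: "(circle ^ 'k) set"
  assumes [measurable]: "E \<in> sets borel" and e: "e > 0"
  shows "\<forall>\<^sub>F y in nhds 0. emeasure torus_borel {t \<in> E. t + torus_proj y \<notin> E} < ennreal e"
proof -
  define A where "A = {x \<in> unit_cube. torus_proj x \<in> E}"
  have A[measurable]: "A \<in> sets borel" unfolding A_def by measurable
  have e2: "e / 2 > 0" using e by simp
  have AL: "A \<in> sets lebesgue" using A by simp
  obtain K where K: "closed K" "K \<subseteq> A" "emeasure lebesgue (A - K) < ennreal (e / 2)"
    using sets_lebesgue_inner_closed[OF AL e2] by metis
  obtain V where V: "open V" "A \<subseteq> V" "emeasure lebesgue (V - A) < ennreal (e / 2)"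
    using sets_lebesgue_outer_open[OF AL e2] by metis
  have [measurable]: "K \<in> sets borel" "V \<in> sets borel" using K V by auto
  have "bounded (unit_cube :: (real ^ 'k) set)"
    by (rule bounded_subset[OF bounded_cbox[of 0 "\<chi> i. 1"]])
       (auto simp: unit_cube_def mem_box_cart less_imp_le)
  then have "compact K"
    using K by (auto simp: compact_eq_bounded_closed A_def intro: bounded_subset)
  then obtain r where r: "r > 0" "(\<Union>x\<in>K. ball x r) \<subseteq> V"
    using compact_subset_open_imp_ball_epsilon_subset[of K V] K V by blast
  have "emeasure torus_borel {t \<in> E. t + torus_proj y \<notin> E} < ennreal e" if y: "norm y < r" for y
  proof -
    have [measurable]: "{t \<in> E. t + torus_proj y \<notin> E} \<in> sets borel" by measurable
    have "emeasure torus_borel {t \<in> E. t + torus_proj y \<notin> E}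
      = emeasure lborel {x \<in> unit_cube. torus_proj x \<in> E \<and> torus_proj (x + y) \<notin> E}"
      by (simp add: emeasure_torus_borel torus_proj_add)
    also have "\<dots> \<le> emeasure lborel ((A - K) \<union> {x. y + x \<in> V - A})"
    proof (rule emeasure_mono)
      show "{x \<in> unit_cube. torus_proj x \<in> E \<and> torus_proj (x + y) \<notin> E} \<subseteq> (A - K) \<union> {x. y + x \<in> V - A}"
      proof
        fix x assume x: "x \<in> {x \<in> unit_cube. torus_proj x \<in> E \<and> torus_proj (x + y) \<notin> E}"
        have "x + y \<in> ball x r" using y by (simp add: dist_norm)
        then have "x \<in> K \<Longrightarrow> x + y \<in> V" using r by blast
        then show "x \<in> (A - K) \<union> {x. y + x \<in> V - A}" using x by (auto simp: A_def add.commute)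
      qed
    qed measurable
    also have "\<dots> \<le> emeasure lborel (A - K) + emeasure lborel {x. y + x \<in> V - A}"
      by (rule emeasure_subadditive) measurable
    also have "emeasure lborel {x. y + x \<in> V - A} = emeasure lborel (V - A)"
      by (subst (2) lborel_distr_plus[of y, symmetric]) (simp add: emeasure_distr vimage_def)
    also have "emeasure lborel (A - K) + emeasure lborel (V - A) < ennreal (e / 2) + ennreal (e / 2)"
      using K V by (intro add_strict_mono) auto
    also have "\<dots> = ennreal e" using e by (simp flip: ennreal_plus)
    finally show ?thesis .
  qed
  then show ?thesis using r(1) by (auto simp: eventually_nhds_metric dist_norm)
qed

lemma set_almost_translation_invariant:
  fixes E :: "(circle ^ 'k) set"
  assumes E: "E \<in> sets torus_lebesgue" and e: "e > 0"
  shows "\<forall>\<^sub>F y in nhds 0. emeasure torus_lebesgue {t \<in> E. t + torus_proj y \<notin> E} < ennreal e"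
proof -
  from E obtain S N N' where S: "E = S \<union> N" "N \<subseteq> N'" "N' \<in> null_sets torus_borel" "S \<in> sets borel"
    unfolding torus_lebesgue_eq by (auto elim: sets_completionE)
  have [measurable]: "S \<in> sets borel" "N' \<in> sets borel" using S by auto
  from borel_set_almost_translation_invariant[OF S(4) e] show ?thesis
  proof eventually_elim
    case (elim y)
    have [measurable]: "{t \<in> S. t + torus_proj y \<notin> S} \<in> sets borel" by measurable
    have "emeasure torus_lebesgue {t \<in> E. t + torus_proj y \<notin> E}
        \<le> emeasure torus_lebesgue ({t \<in> S. t + torus_proj y \<notin> S} \<union> N')"
      using S by (intro emeasure_mono borel_sets_torus_lebesgue) auto
    also have "\<dots> = emeasure torus_borel ({t \<in> S. t + torus_proj y \<notin> S} \<union> N')"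
      by (simp add: torus_lebesgue_eq)
    also have "\<dots> = emeasure torus_borel {t \<in> S. t + torus_proj y \<notin> S}"
      using S by (intro emeasure_Un_null_set) auto
    finally show ?case using elim by (rule le_less_trans)
  qed
qed

section \<open>Quasisturmian measures\<close>

lemma tau_add: "tau \<alpha> (l + l') = tau \<alpha> l + tau \<alpha> l'"
  by (simp add: tau_def torus_zmult_add sum.distrib)

lemma torus_proj_0: "torus_proj 0 = 0"
  by (simp add: torus_proj_def vec_eq_iff zero_circle_def)

lemma torus_proj_sum: "torus_proj (\<Sum>d\<in>A. f d) = (\<Sum>d\<in>A. torus_proj (f d))"
  by (induction A rule: infinite_finite_induct) (simp_all add: torus_proj_0 torus_proj_add)

text \<open>
  The vector \<open>n *s b\<close> acts as the combination, with the fixed coefficients \<open>b\<close>, of the multiples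
  of the generators by \<open>n\<close>. If those multiples are close to \<open>0\<close>, then so is the translation.
\<close>

lemma small_lift_tau_multiple:
  fixes \<alpha> :: "'d::finite \<Rightarrow> circle ^ 'k"
  assumes "\<And>d. torus_zmult n (\<alpha> d) \<in> small_cube q" and "q \<ge> 1"
  shows "\<exists>y. torus_proj y = tau \<alpha> (n *s b) \<and>
    norm y \<le> (\<Sum>d\<in>UNIV. real_of_int \<bar>b $ d\<bar>) * real CARD('k) / of_int q"
proof -
  have "\<forall>d. \<exists>x. torus_proj x = torus_zmult n (\<alpha> d) \<and> (\<forall>i. 0 \<le> x $ i \<and> x $ i < 1 / of_int q)"
    using small_cube_lift[OF assms(1)] by blast
  then obtain x where x: "\<And>d. torus_proj (x d) = torus_zmult n (\<alpha> d)"
    "\<And>d i. 0 \<le> x d $ i \<and> x d $ i < 1 / of_int q"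
    by metis
  let ?y = "\<Sum>d\<in>UNIV. of_int (b $ d) *\<^sub>R x d"
  have "torus_proj ?y = tau \<alpha> (n *s b)"
    by (simp add: tau_def torus_proj_sum torus_proj_zmult x(1) torus_zmult_mult mult.commute)
  moreover have "norm (x d) \<le> real CARD('k) / of_int q" for d
  proof -
    have "norm (x d) \<le> (\<Sum>i\<in>UNIV. \<bar>x d $ i\<bar>)" by (rule norm_le_l1_cart)
    also have "\<dots> \<le> (\<Sum>i\<in>(UNIV::'k set). 1 / of_int q)"
      using x(2) by (intro sum_mono) (simp add: less_imp_le)
    finally show ?thesis by simp
  qed
  then have "norm ?y \<le> (\<Sum>d\<in>UNIV. real_of_int \<bar>b $ d\<bar> * (real CARD('k) / of_int q))"
    by (intro order_trans[OF norm_sum] sum_mono)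
       (simp add: mult_left_mono del: times_divide_eq_right)
  then have "norm ?y \<le> (\<Sum>d\<in>UNIV. real_of_int \<bar>b $ d\<bar>) * real CARD('k) / of_int q"
    by (simp add: sum_distrib_right sum_divide_distrib)
  ultimately show ?thesis by blast
qed

text \<open>
  The letter read at the single point \<open>t\<close>; an itinerary reads it along the orbit.
\<close>

definition symbol :: "nat \<Rightarrow> (nat \<Rightarrow> (circle ^ 'k) set) \<Rightarrow> circle ^ 'k \<Rightarrow> nat" where
  "symbol p P t = (if \<exists>a<p. t \<in> P a then THE a. a < p \<and> t \<in> P a else 0)"

lemma itinerary_eq_symbol: "itinerary p P \<alpha> t l = symbol p P (t + tau \<alpha> l)"
  by (simp only: itinerary_def symbol_def rotation_def)

lemma symbol_outside: "\<not> (\<exists>a<p. t \<in> P a) \<Longrightarrow> symbol p P t = 0"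
  unfolding symbol_def by (rule if_not_P)

context
  fixes p :: nat and P :: "nat \<Rightarrow> (circle ^ 'k) set"
  assumes part: "measurable_partition p P" and p: "p > 0"
begin

lemma symbol_eq:
  assumes "a < p" "t \<in> P a"
  shows "symbol p P t = a"
proof -
  have "b = a" if "b < p" "t \<in> P b" for b
  proof (rule ccontr)
    assume "b \<noteq> a"
    then have "P b \<inter> P a = {}"
      using part assms that by (simp add: measurable_partition_def disjoint_family_on_def)
    then show False using assms that by blast
  qed
  then have "(THE a. a < p \<and> t \<in> P a) = a" using assms by blast
  moreover have "symbol p P t = (THE a. a < p \<and> t \<in> P a)"
    unfolding symbol_def by (rule if_P) (use assms in blast)
  ultimately show ?thesis by (rule trans[rotated])
qed

lemma symbol_less: "symbol p P t < p"
proof (cases "\<exists>a<p. t \<in> P a")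
  case True
  then show ?thesis using symbol_eq by auto
next
  case False
  from symbol_outside[OF this] p show ?thesis by simp
qed

lemma cells_measurable: "a < p \<Longrightarrow> P a \<in> sets torus_lebesgue"
  using part by (simp add: measurable_partition_def)

lemma measurable_symbol: "symbol p P \<in> torus_lebesgue \<rightarrow>\<^sub>M count_space {..<p}"
proof (subst measurable_count_space_eq2)
  have "symbol p P -` {a} \<in> sets torus_lebesgue" if "a < p" for a
  proof -
    let ?U = "\<Union>b<p. P b"
    have "symbol p P -` {a} = P a \<union> (if a = 0 then UNIV - ?U else {})"
    proof (intro equalityI subsetI)
      fix t assume "t \<in> symbol p P -` {a}"
      then show "t \<in> P a \<union> (if a = 0 then UNIV - ?U else {})"
        using symbol_eq by (cases "\<exists>b<p. t \<in> P b") (auto simp: symbol_outside)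
    next
      fix t assume "t \<in> P a \<union> (if a = 0 then UNIV - ?U else {})"
      then show "t \<in> symbol p P -` {a}"
        using symbol_eq that by (auto simp: symbol_outside split: if_splits)
    qed
    moreover have "?U \<in> sets torus_lebesgue" using cells_measurable by auto
    then have "UNIV - ?U \<in> sets torus_lebesgue" by (metis sets.compl_sets space_torus_lebesgue)
    ultimately show ?thesis using cells_measurable[OF that] by auto
  qed
  then show "symbol p P \<in> space torus_lebesgue \<rightarrow> {..<p} \<and>
      (\<forall>a\<in>{..<p}. symbol p P -` {a} \<inter> space torus_lebesgue \<in> sets torus_lebesgue)"
    by (auto simp: symbol_less)
qed simp

lemma measurable_itinerary: "itinerary p P \<alpha> \<in> torus_lebesgue \<rightarrow>\<^sub>M config_space p"
  unfolding config_space_def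
proof (rule measurable_PiM_single')
  show "(\<lambda>t. itinerary p P \<alpha> t l) \<in> torus_lebesgue \<rightarrow>\<^sub>M count_space {..<p}" for l
    unfolding itinerary_eq_symbol
    by (rule measurable_compose[OF measurable_torus_lebesgue_translation measurable_symbol])
qed (auto simp: itinerary_eq_symbol symbol_less)

lemma null_outside_cells: "emeasure torus_lebesgue (UNIV - (\<Union>a<p. P a)) = 0"
proof -
  interpret prob_space "torus_lebesgue :: (circle ^ 'k) measure" by (rule prob_space_torus_lebesgue)
  have U: "(\<Union>a<p. P a) \<in> sets torus_lebesgue" using cells_measurable by auto
  have "emeasure torus_lebesgue (space torus_lebesgue - (\<Union>a<p. P a)) = 1 - 1"
    using part emeasure_space_1 by (subst emeasure_compl[OF U]) (auto simp: measurable_partition_def)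
  then show ?thesis by simp
qed

end

lemma measurable_config_coordinate: "(\<lambda>a. a l) \<in> config_space p \<rightarrow>\<^sub>M count_space UNIV"
proof -
  have "(\<lambda>a. a l) \<in> config_space p \<rightarrow>\<^sub>M count_space {..<p}"
    unfolding config_space_def by (rule measurable_component_singleton) simp
  then show ?thesis by (rule measurable_compose) simp
qed

text \<open>
  All sets of natural numbers are Borel sets, so that the output letter is measurable as a finite sum
  of Borel functions.
\<close>

lemma measurable_linear_ca:
  assumes "p > 0"
  shows "linear_ca p B \<phi> \<in> config_space p \<rightarrow>\<^sub>M config_space p"
proof (subst (2) config_space_def, unfold linear_ca_def[abs_def], rule measurable_PiM_single')
  fix l
  have borel: "M \<rightarrow>\<^sub>M (borel :: nat measure) = M \<rightarrow>\<^sub>M count_space UNIV" for M :: "(int ^ 'a \<Rightarrow> nat) measure"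
    by (rule measurable_cong_sets) (simp_all add: sets_borel_eq_count_space)
  have "(\<lambda>a. \<phi> b * a (l + b)) \<in> config_space p \<rightarrow>\<^sub>M borel" for b
    unfolding borel
    by (rule measurable_compose[OF measurable_config_coordinate]) simp
  then have "(\<lambda>a. \<Sum>b\<in>B. \<phi> b * a (l + b)) \<in> config_space p \<rightarrow>\<^sub>M count_space UNIV"
    unfolding borel[symmetric] by (intro borel_measurable_sum)
  moreover have "(\<lambda>n. n mod p) \<in> count_space UNIV \<rightarrow>\<^sub>M count_space {..<p}" using assms by simp
  ultimately show "(\<lambda>a. (\<Sum>b\<in>B. \<phi> b * a (l + b)) mod p) \<in> config_space p \<rightarrow>\<^sub>M count_space {..<p}"
    by (rule measurable_compose)
qed (use assms in auto)

text \<open>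
  There are only countably many coordinates, so if each of them vanishes almost surely, they all do
  so simultaneously.
\<close>

lemma measure_eq_return_zero:
  assumes p: "p > 0" and "prob_space \<mu>" and sets: "sets \<mu> = sets (config_space p)"
    and zero: "\<And>l. emeasure \<mu> {a \<in> space \<mu>. a l \<noteq> 0} = 0"
  shows "\<mu> = return (config_space p) (\<lambda>_. 0 :: nat)"
proof (rule measure_eqI)
  interpret prob_space \<mu> by fact
  fix A assume A: "A \<in> sets \<mu>"
  have m: "{a \<in> space \<mu>. a l \<noteq> 0} \<in> sets \<mu>" for l
  proof -
    have "(\<lambda>a. a l) \<in> \<mu> \<rightarrow>\<^sub>M count_space UNIV"
      using measurable_config_coordinate measurable_cong_sets[OF sets refl] by blast
    from measurable_sets[OF this, of "- {0}"] show ?thesis by (auto simp: vimage_def Int_def conj_commute)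
  qed
  have "AE a in \<mu>. \<forall>l. a l = 0"
    unfolding AE_all_countable using m zero by (intro allI AE_I[of _ _ "{a \<in> space \<mu>. a l \<noteq> 0}" for l]) auto
  then have *: "AE a in \<mu>. a = (\<lambda>_. 0)" by eventually_elim auto
  have "emeasure \<mu> A = indicator A (\<lambda>_. 0)"
  proof (cases "(\<lambda>_. 0) \<in> A")
    case True
    have "emeasure \<mu> A = emeasure \<mu> (space \<mu>)"
      using * A True by (intro emeasure_eq_AE) auto
    then show ?thesis using True by (simp add: emeasure_space_1)
  next
    case False
    have "emeasure \<mu> A = emeasure \<mu> {}"
      using * A False by (intro emeasure_eq_AE) auto
    then show ?thesis using False by simp
  qed
  then show "emeasure \<mu> A = emeasure (return (config_space p) (\<lambda>_. 0)) A"
    using A sets by simp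
qed (simp add: sets)

lemma funpow_invariant_measure:
  assumes "\<Phi> \<in> M \<rightarrow>\<^sub>M M" "sets \<mu> = sets M" "distr \<mu> M \<Phi> = \<mu>"
  shows "\<Phi> ^^ n \<in> M \<rightarrow>\<^sub>M M" "distr \<mu> M (\<Phi> ^^ n) = \<mu>"
proof (induction n)
  case 0
  show "\<Phi> ^^ 0 \<in> M \<rightarrow>\<^sub>M M" "distr \<mu> M (\<Phi> ^^ 0) = \<mu>"
    using assms(2) by (auto simp: id_def distr_id2)
next
  case (Suc n)
  show "\<Phi> ^^ Suc n \<in> M \<rightarrow>\<^sub>M M" using Suc assms(1) by (simp add: measurable_comp)
  have "distr \<mu> M (\<Phi> ^^ Suc n) = distr (distr \<mu> M (\<Phi> ^^ n)) M \<Phi>"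
    using Suc assms by (subst distr_distr) (auto cong: measurable_cong_sets)
  then show "distr \<mu> M (\<Phi> ^^ Suc n) = \<mu>" using Suc assms by simp
qed

text \<open>
  By invariance, the \<open>p ^ n\<close>-th iterate of the automaton produces a nonzero letter at \<open>l\<close> with the same
  probability as the configuration itself shows one. This iterate sees the letters at
  \<open>l + p ^ n *s b\<close>, that is, at translates of one point of the torus by the small elements \<open>s b\<close>. Unless one
  of these translations leaves the cell of that point, all letters are equal, and the vanishing
  trace makes the output \<open>0\<close>. The exceptional set has arbitrarily small measure.
\<close>

lemma invariant_quasisturmian_trivial:
  fixes B :: "(int ^ 'd) set" and \<alpha> :: "'d \<Rightarrow> circle ^ 'k"
  assumes p: "prime p" and B: "finite B" and tr: "ca_trace p B \<phi> = 0"
    and small: "\<And>m. \<exists>n. \<forall>d. torus_zmult (int (p ^ n)) (\<alpha> d) \<in> small_cube (int (p ^ m))"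
    and part: "measurable_partition p P"
    and \<mu>: "\<mu> = distr torus_lebesgue (config_space p) (itinerary p P \<alpha>)"
    and inv: "distr \<mu> (config_space p) (linear_ca p B \<phi>) = \<mu>"
  shows "\<mu> = return (config_space p) (\<lambda>_. 0)"
proof -
  have p0: "p > 0" using p by (rule prime_gt_0_nat)
  note itin = measurable_itinerary[OF part p0, of \<alpha>]
  note ca = measurable_linear_ca[OF p0, of B \<phi>]
  let ?L = "torus_lebesgue :: (circle ^ 'k) measure"
  interpret L: prob_space ?L by (rule prob_space_torus_lebesgue)
  have prob: "prob_space \<mu>" unfolding \<mu> by (rule L.prob_space_distr[OF itin])
  have sets: "sets \<mu> = sets (config_space p)"
    and space: "space \<mu> = space (config_space p)" by (simp_all add: \<mu>)
  define U where "U = (\<Union>a<p. P a)"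
  have cells: "P a \<in> sets ?L" if "a < p" for a using cells_measurable[OF part p0 that] .
  have U: "U \<in> sets ?L" unfolding U_def using cells by auto
  have trans: "{t. t + s \<in> E} \<in> sets ?L" if "E \<in> sets ?L" for s E
    using measurable_sets[OF measurable_torus_lebesgue_translation that, of s] by (simp add: vimage_def)
  have bound: "emeasure \<mu> {a \<in> space \<mu>. a l \<noteq> 0} \<le> of_nat (p * card B) * ennreal e" if e: "e > 0" for l e
  proof -
    have "\<forall>\<^sub>F y in nhds 0. \<forall>a\<in>{..<p}. emeasure ?L {t \<in> P a. t + torus_proj y \<notin> P a} < ennreal e"
      using cells e by (intro eventually_ball_finite ballI set_almost_translation_invariant) auto
    then obtain r where r: "r > 0"
      "\<And>y a. norm y < r \<Longrightarrow> a < p \<Longrightarrow> emeasure ?L {t \<in> P a. t + torus_proj y \<notin> P a} < ennreal e"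
      by (auto simp: eventually_nhds_metric dist_norm)
    \<comment> \<open>\<open>C / p ^ m\<close> bounds the lengths of all translations \<open>s b\<close> once the multiples of the
        generators lie in the cube of side \<open>1 / p ^ m\<close>.\<close>
    define C where "C = (\<Sum>b\<in>B. (\<Sum>d\<in>UNIV. real_of_int \<bar>b $ d\<bar>) * real CARD('k))"
    obtain m where m: "C / r < real p ^ m"
      using real_arch_pow[of "real p" "C / r"] prime_gt_1_nat[OF p] by auto
    obtain n where n: "\<And>d. torus_zmult (int (p ^ n)) (\<alpha> d) \<in> small_cube (int (p ^ m))"
      using small by blast
    define s where "s b = tau \<alpha> (int (p ^ n) *s b)" for b
    have s: "emeasure ?L {t \<in> P a. t + s b \<notin> P a} < ennreal e" if "b \<in> B" "a < p" for a b
    proof -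
      have "int (p ^ m) \<ge> 1" using p0 by (simp del: of_nat_power)
      from small_lift_tau_multiple[where \<alpha> = \<alpha> and b = b, OF n this] obtain y where y: "torus_proj y = s b"
        "norm y \<le> (\<Sum>d\<in>UNIV. real_of_int \<bar>b $ d\<bar>) * real CARD('k) / real p ^ m"
        by (auto simp: s_def)
      have "(\<Sum>d\<in>UNIV. real_of_int \<bar>b $ d\<bar>) * real CARD('k) \<le> C"
        unfolding C_def using B \<open>b \<in> B\<close> by (intro member_le_sum) (auto intro!: mult_nonneg_nonneg sum_nonneg)
      also have "C < r * real p ^ m" using m r by (simp add: field_simps)
      finally have "(\<Sum>d\<in>UNIV. real_of_int \<bar>b $ d\<bar>) * real CARD('k) / real p ^ m < r"
        using p0 by (simp add: pos_divide_less_eq)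
      with y have "norm y < r" by linarith
      from r(2)[OF this \<open>a < p\<close>] show ?thesis unfolding y(1) .
    qed
    \<comment> \<open>Outside \<open>D\<close>, a point and its translates by all \<open>s b\<close> lie in a common cell.\<close>
    define D where "D = {t. t \<notin> U} \<union> (\<Union>a<p. \<Union>b\<in>B. {t \<in> P a. t + s b \<notin> P a})"
    have Dab: "{t \<in> P a. t + s b \<notin> P a} \<in> sets ?L" if "a < p" for a b
    proof -
      have "{t \<in> P a. t + s b \<notin> P a} = P a - {t. t + s b \<in> P a}" by auto
      then show ?thesis using cells[OF that] trans by auto
    qed
    have DU: "{t. t \<notin> U} \<in> sets ?L"
      using sets.compl_sets[OF U] by (simp add: set_diff_eq)
    have D: "D \<in> sets ?L" unfolding D_def using DU Dab B by (intro sets.Un sets.finite_UN) auto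
    have emD: "emeasure ?L D \<le> of_nat (p * card B) * ennreal e"
    proof -
      have "emeasure ?L D \<le> emeasure ?L {t. t \<notin> U} + emeasure ?L (\<Union>a<p. \<Union>b\<in>B. {t \<in> P a. t + s b \<notin> P a})"
        unfolding D_def using DU Dab B by (intro emeasure_subadditive sets.finite_UN) auto
      also have "emeasure ?L {t. t \<notin> U} = 0"
        using null_outside_cells[OF part p0] by (simp add: U_def set_diff_eq)
      also have "emeasure ?L (\<Union>a<p. \<Union>b\<in>B. {t \<in> P a. t + s b \<notin> P a})
          \<le> (\<Sum>a<p. emeasure ?L (\<Union>b\<in>B. {t \<in> P a. t + s b \<notin> P a}))"
        using Dab B by (intro emeasure_subadditive_finite) auto
      also have "\<dots> \<le> (\<Sum>a<p. \<Sum>b\<in>B. emeasure ?L {t \<in> P a. t + s b \<notin> P a})"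
        using Dab B by (intro sum_mono emeasure_subadditive_finite) auto
      also have "\<dots> \<le> (\<Sum>a<p. \<Sum>b\<in>B. ennreal e)"
        using s by (intro sum_mono) (auto intro: less_imp_le)
      also have "\<dots> = of_nat (p * card B) * ennreal e" by (simp add: mult.assoc)
      finally show ?thesis by simp
    qed
    let ?\<Psi> = "linear_ca p B \<phi> ^^ (p ^ n)"
    have \<Psi>: "?\<Psi> \<in> config_space p \<rightarrow>\<^sub>M config_space p" "distr \<mu> (config_space p) ?\<Psi> = \<mu>"
      using funpow_invariant_measure[OF ca sets inv] by auto
    let ?Z = "{a \<in> space (config_space p). a l \<noteq> 0}"
    have Z: "?Z \<in> sets (config_space p)"
      using measurable_sets[OF measurable_config_coordinate, of "- {0}" l p]
      by (auto simp: vimage_def Int_def conj_commute)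
    have "emeasure \<mu> ?Z = emeasure (distr \<mu> (config_space p) ?\<Psi>) ?Z" by (simp add: \<Psi>)
    also have "distr \<mu> (config_space p) ?\<Psi> = distr ?L (config_space p) (?\<Psi> \<circ> itinerary p P \<alpha>)"
      unfolding \<mu> using \<Psi>(1) itin by (rule distr_distr)
    also have "emeasure \<dots> ?Z = emeasure ?L ((?\<Psi> \<circ> itinerary p P \<alpha>) -` ?Z \<inter> space ?L)"
      using \<Psi>(1) itin Z by (intro emeasure_distr) auto
    also have "\<dots> \<le> emeasure ?L {t. t + tau \<alpha> l \<in> D}"
    proof (rule emeasure_mono)
      show "(?\<Psi> \<circ> itinerary p P \<alpha>) -` ?Z \<inter> space ?L \<subseteq> {t. t + tau \<alpha> l \<in> D}"
      proof (intro subsetI CollectI, rule ccontr)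
        fix t assume t: "t \<in> (?\<Psi> \<circ> itinerary p P \<alpha>) -` ?Z \<inter> space ?L" and nD: "t + tau \<alpha> l \<notin> D"
        let ?u = "t + tau \<alpha> l"
        from nD obtain a where a: "a < p" "?u \<in> P a" by (auto simp: D_def U_def)
        have "itinerary p P \<alpha> t (l + int (p ^ n) *s b) = a" if "b \<in> B" for b
        proof -
          have "?u + s b \<in> P a" using nD a that by (auto simp: D_def)
          then show ?thesis
            using symbol_eq[OF part p0 a(1)] by (simp add: itinerary_eq_symbol tau_add s_def add.assoc)
        qed
        then have "?\<Psi> (itinerary p P \<alpha> t) l = (\<Sum>b\<in>B. \<phi> b * a) mod p"
          by (simp add: funpow_prime_power_linear_ca[OF p B])
        also have "\<dots> = ca_trace p B \<phi> * a mod p"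
          by (simp add: ca_trace_def mod_mult_left_eq flip: sum_distrib_right)
        finally show False using t tr by simp
      qed
      show "{t. t + tau \<alpha> l \<in> D} \<in> sets ?L" using trans[OF D] .
    qed
    also have "\<dots> = emeasure ?L D" using D by (rule emeasure_torus_lebesgue_translation)
    also have "\<dots> \<le> of_nat (p * card B) * ennreal e" by (rule emD)
    finally show ?thesis by (simp add: space)
  qed
  have "emeasure \<mu> {a \<in> space \<mu>. a l \<noteq> 0} = 0" for l
  proof -
    have *: "emeasure \<mu> {a \<in> space \<mu>. a l \<noteq> 0} \<le> 0 + ennreal \<epsilon>" if "\<epsilon> > 0" for \<epsilon>
    proof -
      \<comment> \<open>The summand \<open>1\<close> keeps the denominator positive when the neighbourhood is empty.\<close>
      let ?e = "\<epsilon> / real (p * card B + 1)"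
      have e: "?e > 0" using that by (intro divide_pos_pos) (simp_all add: add_pos_nonneg)
      have "emeasure \<mu> {a \<in> space \<mu>. a l \<noteq> 0} \<le> of_nat (p * card B) * ennreal ?e"
        by (rule bound[OF e])
      also have "\<dots> = ennreal (real (p * card B) * ?e)"
        using e by
          (simp only: ennreal_of_nat_eq_real_of_nat ennreal_mult[symmetric] of_nat_0_le_iff less_imp_le)
      also have "\<dots> \<le> ennreal \<epsilon>"
      proof (rule ennreal_leI)
        have "real N * (\<epsilon> / real (N + 1)) \<le> \<epsilon>" for N using that by (simp add: field_simps)
        then show "real (p * card B) * ?e \<le> \<epsilon>" .
      qed
      finally show ?thesis by simp
    qed
    have "emeasure \<mu> {a \<in> space \<mu>. a l \<noteq> 0} \<le> 0"
      by (rule ennreal_le_epsilon) (rule *)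
    then show ?thesis by simp
  qed
  then show ?thesis by (rule measure_eq_return_zero[OF p0 prob sets])
qed

theorem proposition14p5:
  fixes p :: nat
    and B :: "(int ^ 'd) set"
    and \<phi> :: "int ^ 'd \<Rightarrow> nat"
  assumes "prime p"
    and "finite B"
    and "\<forall>b\<in>B. \<phi> b \<in> {1..p - 1}"
    and "ca_trace p B \<phi> = 0"
  shows "AE \<alpha> in (\<Pi>\<^sub>M d\<in>(UNIV :: 'd set). (torus_lebesgue :: (circle ^ 'k) measure)).
           admissible \<alpha> \<longrightarrow>
             (\<forall>\<mu>. quasisturmian p \<alpha> \<mu> \<and> ca_invariant p (linear_ca p B \<phi>) \<mu> \<longrightarrow>
                  \<mu> = return (config_space p) (\<lambda>_. 0))"
  using AE_multiples_approach_0[OF prime_ge_2_nat[OF assms(1)]]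
proof eventually_elim
  case (elim \<alpha>)
  have "\<mu> = return (config_space p) (\<lambda>_. 0)"
    if "quasisturmian p \<alpha> \<mu>" "ca_invariant p (linear_ca p B \<phi>) \<mu>" for \<mu>
  proof -
    obtain P where "measurable_partition p P"
      "\<mu> = distr torus_lebesgue (config_space p) (itinerary p P \<alpha>)"
      using \<open>quasisturmian p \<alpha> \<mu>\<close> by (auto simp: quasisturmian_def)
    with elim that(2) assms show ?thesis
      by (intro invariant_quasisturmian_trivial[of p B \<phi> \<alpha> P]) (auto simp: ca_invariant_def)
  qed
  then show ?case by blast
qed

end
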